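(* Let $(z,z',w,w')$ be admissible and $N\ge1$. There exists a Feller semigroup on $\Omega_N$ whose generator is the operator $D_{z,z',w,w'\mid N}$ with domain $$\{f\in C_0(\Omega_N): D_{z,z',w,w'\mid N}f\in C_0(\Omega_N)\}.$$
   Context: State space and the difference operator: - $\Omega_N=\{\mathbf n=(n_1,\dots,n_N)\in\mathbb Z^N: n_1>n_2>\dots>n_N\}$, a discrete space. - $V(\mathbf n)=\prod_{1\le i<j\le N}(n_i-n_j)$, and $\epsilon_k$ is the $k$th standard basis vector of $\mathbb Z^N$. - For a function $f$ on $\Omega_N$, $$(D_{z,z',w,w'\mid N}f)(\mathbf n)=\sum_{k=1}^N\Big(\frac{V(\mathbf n+\epsilon_k)}{V(\mathbf n)}(z+N-1-n_k)(z'+N-1-n_k)\,(f(\mathbf n+\epsilon_k)-f(\mathbf n))+\frac{V(\mathbf n-\epsilon_k)}{V(\mathbf n)}(w+n_k)(w'+n_k)\,(f(\mathbf n-\epsilon_k)-f(\mathbf n))\Big).$$ - This is well defined, since $V(\mathbf n\pm\epsilon_k)=0$ whenever $\mathbf n\pm\epsilon_k\notin\Omega_N$; it annihilates constants. Admissibility: $(z,z',w,w')\in\mathbb C^4$ is admissible if both of the following hold: - $(z+k)(z'+k)>0$ and $(w+k)(w'+k)>0$ for all $k\in\mathbb Z$; - $\mathrm{Re}(z+z'+w+w')>-1$. Feller semigroups: for a locally compact space $X$, $C_0(X)$ is the Banach space of real continuous functions vanishing at infinity with the sup norm. A Feller semigroup is a strongly continuous semigroup $P(t)$, $t\ge0$,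 on $C_0(X)$ given by Markov (probability) kernels. Its generator is $Af=\lim_{t\to+0}(P(t)f-f)/t$, on the set of $f$ where the limit exists in norm. *)

theory Defs
  imports "HOL-Analysis.Analysis"
begin

text \<open>The state space Omega_N: strictly decreasing integer N-tuples, encoded as lists
  (list position k, 0-based, is the paper's coordinate k+1).\<close>
definition Omega :: "nat \<Rightarrow> int list set" where
  "Omega N = {n. length n = N \<and> sorted_wrt (\<lambda>a b. a > b) n}"

definition Vdm :: "int list \<Rightarrow> int" where
  "Vdm n = (\<Prod>i<length n. \<Prod>j\<in>{i<..<length n}. (n ! i - n ! j))"

definition shift_up :: "int list \<Rightarrow> nat \<Rightarrow> int list" where
  "shift_up n k = n[k := n ! k + 1]"
definition shift_down :: "int list \<Rightarrow> nat \<Rightarrow> int list" where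
  "shift_down n k = n[k := n ! k - 1]"

definition admissible :: "complex \<Rightarrow> complex \<Rightarrow> complex \<Rightarrow> complex \<Rightarrow> bool" where
  "admissible z z' w w' \<longleftrightarrow>
     (\<forall>k::int. Im ((z + of_int k) * (z' + of_int k)) = 0 \<and> Re ((z + of_int k) * (z' + of_int k)) > 0) \<and>
     (\<forall>k::int. Im ((w + of_int k) * (w' + of_int k)) = 0 \<and> Re ((w + of_int k) * (w' + of_int k)) > 0) \<and>
     Re (z + z' + w + w') > -1"

text \<open>The difference operator D_{z,z',w,w'|N}.  Under admissibility the products
  (z+N-1-n_k)(z'+N-1-n_k) and (w+n_k)(w'+n_k) are real, so taking their real part is harmless.\<close>
definition Dop :: "complex \<Rightarrow> complex \<Rightarrow> complex \<Rightarrow> complex \<Rightarrow> nat \<Rightarrow> (int list \<Rightarrow> real) \<Rightarrow> int list \<Rightarrow> real" where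
  "Dop z z' w w' N f n =
     (\<Sum>k<N.
        real_of_int (Vdm (shift_up n k)) / real_of_int (Vdm n)
          * Re ((z + of_nat N - 1 - of_int (n ! k)) * (z' + of_nat N - 1 - of_int (n ! k)))
          * (f (shift_up n k) - f n)
      + real_of_int (Vdm (shift_down n k)) / real_of_int (Vdm n)
          * Re ((w + of_int (n ! k)) * (w' + of_int (n ! k)))
          * (f (shift_down n k) - f n))"

text \<open>C_0(Omega_N): real functions on the discrete space Omega_N vanishing at infinity
  (only the values on Omega_N matter).\<close>
definition C0 :: "nat \<Rightarrow> (int list \<Rightarrow> real) set" where
  "C0 N = {f. \<forall>e>0. finite {x \<in> Omega N. e \<le> \<bar>f x\<bar>}}"

definition supnorm :: "nat \<Rightarrow> (int list \<Rightarrow> real) \<Rightarrow> real" where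
  "supnorm N g = (SUP x\<in>Omega N. \<bar>g x\<bar>)"

definition kernel_op :: "nat \<Rightarrow> (real \<Rightarrow> int list \<Rightarrow> int list \<Rightarrow> real) \<Rightarrow> real \<Rightarrow> (int list \<Rightarrow> real) \<Rightarrow> int list \<Rightarrow> real" where
  "kernel_op N p t f x = (\<Sum>\<^sub>\<infinity>y\<in>Omega N. p t x y * f y)"

definition feller_semigroup :: "nat \<Rightarrow> (real \<Rightarrow> int list \<Rightarrow> int list \<Rightarrow> real) \<Rightarrow> bool" where
  "feller_semigroup N p \<longleftrightarrow>
     (\<forall>t\<ge>0. \<forall>x\<in>Omega N. (\<forall>y\<in>Omega N. p t x y \<ge> 0) \<and>
        p t x summable_on Omega N \<and> (\<Sum>\<^sub>\<infinity>y\<in>Omega N. p t x y) = 1) \<and>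
     (\<forall>t\<ge>0. \<forall>f\<in>C0 N. kernel_op N p t f \<in> C0 N) \<and>
     (\<forall>f\<in>C0 N. \<forall>x\<in>Omega N. kernel_op N p 0 f x = f x) \<and>
     (\<forall>s\<ge>0. \<forall>t\<ge>0. \<forall>f\<in>C0 N. \<forall>x\<in>Omega N.
        kernel_op N p (s + t) f x = kernel_op N p s (kernel_op N p t f) x) \<and>
     (\<forall>f\<in>C0 N. ((\<lambda>t. supnorm N (\<lambda>x. kernel_op N p t f x - f x)) \<longlongrightarrow> 0) (at_right 0))"

definition generator_at :: "nat \<Rightarrow> (real \<Rightarrow> int list \<Rightarrow> int list \<Rightarrow> real) \<Rightarrow> (int list \<Rightarrow> real) \<Rightarrow> (int list \<Rightarrow> real) \<Rightarrow> bool" where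
  "generator_at N p f g \<longleftrightarrow> f \<in> C0 N \<and> g \<in> C0 N \<and>
     ((\<lambda>t. supnorm N (\<lambda>x. (kernel_op N p t f x - f x) / t - g x)) \<longlongrightarrow> 0) (at_right 0)"

end

theory Submission
  imports Defs
begin

text \<open>Write \<open>A\<close> for the difference operator and \<open>\<Phi> = 1 + \<Sum>\<^sub>k n\<^sub>k\<^sup>2\<close>. The jump rates are \<open>O(\<Phi>)\<close>, and
  although a single jump contributes to the drift of \<open>\<Phi>\<close> a term of order \<open>\<bar>n\<bar>\<^sup>3\<close>, the cubic parts of the
  upward and downward jumps cancel in the sum over \<open>k\<close>, so that \<open>\<bar>A \<Phi>\<bar> \<le> M \<Phi>\<close>. Hence also
  \<open>A (\<Phi>\<^sup>-\<^sup>2) \<le> C \<Phi>\<^sup>-\<^sup>2\<close>. The first inequality excludes explosion, the second one gives the Feller property.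

  The semigroup is the limit of \<open>K\<^sub>h\<^sup>j f\<close> with \<open>h = 2\<^sup>-\<^sup>m\<close> and \<open>j = \<lfloor>t / h\<rfloor>\<close>, where \<open>K\<^sub>h = 1 + h A\<close> frozen at the
  points where \<open>h \<Phi>\<close> is large. On functions that are \<open>O(\<Phi>\<^sup>-\<^sup>2)\<close>, a space preserved by \<open>K\<^sub>h\<close> and dense in \<open>C\<^sub>0\<close>,
  the operators \<open>A\<close> and \<open>A\<^sup>2\<close> are bounded in sup norm; this yields convergence and the second-order Taylor
  expansion in \<open>t\<close>. The maximum principle and an approximate resolvent show that these functions form a core
  for \<open>A\<close> on its maximal domain. Conversely, conservativity makes \<open>P\<^sub>t f(x)\<close> differentiable at \<open>t = 0\<close> for
  every \<open>f\<close> in \<open>C\<^sub>0\<close>, with derivative \<open>A f(x)\<close>.\<close>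

section \<open>Functions vanishing at infinity\<close>

definition vanishing :: "'a set \<Rightarrow> ('a \<Rightarrow> real) set" where
  "vanishing X = {f. \<forall>e>0. finite {x \<in> X. e \<le> \<bar>f x\<bar>}}"

lemma vanishing_bounded:
  assumes "f \<in> vanishing X"
  obtains c where "0 \<le> c" "\<And>x. x \<in> X \<Longrightarrow> \<bar>f x\<bar> \<le> c"
proof
  let ?S = "{x \<in> X. 1 \<le> \<bar>f x\<bar>}"
  have fin: "finite ?S" using assms by (auto simp: vanishing_def)
  show "0 \<le> 1 + (\<Sum>x\<in>?S. \<bar>f x\<bar>)" by (simp add: sum_nonneg add_nonneg_nonneg)
  fix x assume "x \<in> X"
  have "\<bar>f x\<bar> \<le> (\<Sum>x\<in>?S. \<bar>f x\<bar>)" if "x \<in> ?S"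
    using that fin by (intro member_le_sum) auto
  moreover have "0 \<le> (\<Sum>x\<in>?S. \<bar>f x\<bar>)" by (simp add: sum_nonneg)
  moreover have "\<bar>f x\<bar> < 1" if "x \<notin> ?S" using that \<open>x \<in> X\<close> by auto
  ultimately show "\<bar>f x\<bar> \<le> 1 + (\<Sum>x\<in>?S. \<bar>f x\<bar>)" by (cases "x \<in> ?S") linarith+
qed

lemma vanishing_closed:
  assumes "\<And>e. 0 < e \<Longrightarrow> \<exists>g\<in>vanishing X. \<forall>x\<in>X. \<bar>f x - g x\<bar> \<le> e"
  shows "f \<in> vanishing X"
  unfolding vanishing_def
proof (intro CollectI allI impI)
  fix e :: real assume e: "0 < e"
  then obtain g where g: "g \<in> vanishing X" "\<And>x. x \<in> X \<Longrightarrow> \<bar>f x - g x\<bar> \<le> e/2"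
    using assms[of "e/2"] by auto
  have "finite {x \<in> X. e/2 \<le> \<bar>g x\<bar>}" using g(1) half_gt_zero[OF e] unfolding vanishing_def by blast
  moreover have "{x \<in> X. e \<le> \<bar>f x\<bar>} \<subseteq> {x \<in> X. e/2 \<le> \<bar>g x\<bar>}"
  proof clarify
    fix x assume "x \<in> X" "e \<le> \<bar>f x\<bar>"
    with g(2)[of x] show "e/2 \<le> \<bar>g x\<bar>" by linarith
  qed
  ultimately show "finite {x \<in> X. e \<le> \<bar>f x\<bar>}" using finite_subset by blast
qed

lemma vanishing_cong:
  assumes "\<And>x. x \<in> X \<Longrightarrow> f x = g x"
  shows "f \<in> vanishing X \<longleftrightarrow> g \<in> vanishing X"
proof -
  have "{x \<in> X. e \<le> \<bar>f x\<bar>} = {x \<in> X. e \<le> \<bar>g x\<bar>}" for e using assms by auto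
  then show ?thesis by (simp add: vanishing_def)
qed

lemma vanishing_scale:
  assumes "f \<in> vanishing X"
  shows "(\<lambda>x. a * f x) \<in> vanishing X"
proof (cases "a = 0")
  case False
  have "{x \<in> X. e \<le> \<bar>a * f x\<bar>} = {x \<in> X. e / \<bar>a\<bar> \<le> \<bar>f x\<bar>}" for e
    using False by (auto simp: abs_mult field_simps)
  then show ?thesis using assms False by (auto simp: vanishing_def)
qed (auto simp: vanishing_def)

lemma vanishing_add:
  assumes "f \<in> vanishing X" "g \<in> vanishing X"
  shows "(\<lambda>x. f x + g x) \<in> vanishing X"
  unfolding vanishing_def
proof (intro CollectI allI impI)
  fix e :: real assume e: "0 < e"
  have "{x \<in> X. e \<le> \<bar>f x + g x\<bar>} \<subseteq> {x \<in> X. e/2 \<le> \<bar>f x\<bar>} \<union> {x \<in> X. e/2 \<le> \<bar>g x\<bar>}"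
    by auto
  moreover have "finite {x \<in> X. e/2 \<le> \<bar>f x\<bar>}" "finite {x \<in> X. e/2 \<le> \<bar>g x\<bar>}"
    using assms half_gt_zero[OF e] unfolding vanishing_def by blast+
  ultimately show "finite {x \<in> X. e \<le> \<bar>f x + g x\<bar>}" by (meson finite_Un finite_subset)
qed

lemma vanishing_diff:
  assumes "f \<in> vanishing X" "g \<in> vanishing X"
  shows "(\<lambda>x. f x - g x) \<in> vanishing X"
  using vanishing_add[OF assms(1) vanishing_scale[OF assms(2), of "-1"]] by simp

lemma vanishing_finite_support:
  assumes "finite F"
  shows "(\<lambda>x. f x * indicat_real F x) \<in> vanishing X"
  unfolding vanishing_def
proof (intro CollectI allI impI)
  fix e :: real assume "0 < e"
  then have "{x \<in> X. e \<le> \<bar>f x * indicat_real F x\<bar>} \<subseteq> F" by (auto simp: indicator_def)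
  then show "finite {x \<in> X. e \<le> \<bar>f x * indicat_real F x\<bar>}" using assms finite_subset by blast
qed

text \<open>The finite set may be enlarged freely because \<open>P_has_sum\<close> needs a limit
  along all finite sets; the density arguments take \<open>G = F\<close>.\<close>

lemma vanishing_approx:
  assumes "f \<in> vanishing X" "0 < e"
  obtains F where "finite F" "F \<subseteq> X"
    "\<And>G x. F \<subseteq> G \<Longrightarrow> x \<in> X \<Longrightarrow> \<bar>f x - f x * indicat_real G x\<bar> \<le> e"
proof
  let ?F = "{x \<in> X. e \<le> \<bar>f x\<bar>}"
  show "finite ?F" using assms by (auto simp: vanishing_def)
  show "?F \<subseteq> X" by auto
  show "\<bar>f x - f x * indicat_real G x\<bar> \<le> e" if "?F \<subseteq> G" "x \<in> X" for G x
    using that assms(2) by (cases "x \<in> G") fastforce+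
qed

section \<open>Markov chains with a quadratic Lyapunov function\<close>

text \<open>\<open>jump_in\<close> is asked only where the rate is nonzero: a shifted tuple can
  leave the state space, and there the Vandermonde ratio is zero. \<open>drift_le\<close> is
  two-sided because its upper half bounds the growth of \<Phi> and its lower half that of
  1/\<Phi>^2; the latter also rests on \<open>Phi_jump\<close> and \<open>Phi_incr\<close>.\<close>

locale lyapunov_chain =
  fixes X :: "'a set" and I :: "'i set" and r :: "'i \<Rightarrow> 'a \<Rightarrow> real"
    and \<sigma> :: "'i \<Rightarrow> 'a \<Rightarrow> 'a" and \<Phi> :: "'a \<Rightarrow> real" and M :: real
  assumes finite_I: "finite I"
    and rate_nonneg: "i \<in> I \<Longrightarrow> x \<in> X \<Longrightarrow> 0 \<le> r i x"
    and jump_in: "i \<in> I \<Longrightarrow> x \<in> X \<Longrightarrow> r i x \<noteq> 0 \<Longrightarrow> \<sigma> i x \<in> X"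
    and Phi_ge_1: "x \<in> X \<Longrightarrow> 1 \<le> \<Phi> x"
    and finite_sublevel: "finite {x \<in> X. \<Phi> x \<le> R}"
    and M_ge_1: "1 \<le> M"
    and rate_le: "x \<in> X \<Longrightarrow> (\<Sum>i\<in>I. r i x) \<le> M * \<Phi> x"
    and drift_le: "x \<in> X \<Longrightarrow> \<bar>\<Sum>i\<in>I. r i x * (\<Phi> (\<sigma> i x) - \<Phi> x)\<bar> \<le> M * \<Phi> x"
    and Phi_jump: "i \<in> I \<Longrightarrow> x \<in> X \<Longrightarrow> \<Phi> x \<le> M * \<Phi> (\<sigma> i x)"
    and Phi_incr: "i \<in> I \<Longrightarrow> x \<in> X \<Longrightarrow> (\<Phi> (\<sigma> i x) - \<Phi> x)\<^sup>2 \<le> M * \<Phi> x"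
begin

definition A :: "('a \<Rightarrow> real) \<Rightarrow> 'a \<Rightarrow> real" where
  "A f x = (\<Sum>i\<in>I. r i x * (f (\<sigma> i x) - f x))"

text \<open>\<open>B\<close> combines the total rate with the values (M/\<Phi>)^2 at neighbours and
  1/\<Phi>^2 at the point itself. In \<open>C\<close>, the summand \<open>2 * M\<close> comes from
  the drift and \<open>M^3 * (M + 2)\<close> from the quadratic remainder in
  \<open>A_inverse_square\<close>.\<close>

definition "B = M * (M\<^sup>2 + 1)"
definition "C = 2 * M + M^3 * (M + 2)"

lemma M_pos: "0 < M" and B_pos: "0 < B" and C_ge: "M \<le> C" and C_pos: "0 < C"
proof -
  show M: "0 < M" using M_ge_1 by simp
  then show "0 < B" by (simp add: B_def add_pos_pos)
  have "0 \<le> M^3 * (M + 2)" using M by simp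
  then show "M \<le> C" "0 < C" using M unfolding C_def by linarith+
qed

lemma Phi_pos: "x \<in> X \<Longrightarrow> 0 < \<Phi> x"
  using Phi_ge_1 by force

lemma A_lin: "A (\<lambda>x. a * f x + b * g x) x = a * A f x + b * A g x"
  unfolding A_def by (simp add: sum_distrib_left sum.distrib[symmetric] algebra_simps)

lemma A_diff: "A (\<lambda>x. f x - g x) x = A f x - A g x"
  using A_lin[of 1 f "-1" g] by simp

section \<open>Bounds for \<open>A\<close> on functions decaying like a power of 1/\<Phi>\<close>

lemma A_bound:
  assumes x: "x \<in> X" and u: "0 \<le> u" "\<And>i. i \<in> I \<Longrightarrow> r i x \<noteq> 0 \<Longrightarrow> \<bar>f (\<sigma> i x)\<bar> \<le> u"
    and v: "\<bar>f x\<bar> \<le> v"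
  shows "\<bar>A f x\<bar> \<le> M * \<Phi> x * (u + v)"
proof -
  have "\<bar>A f x\<bar> \<le> (\<Sum>i\<in>I. \<bar>r i x * (f (\<sigma> i x) - f x)\<bar>)" unfolding A_def by (rule sum_abs)
  also have "\<dots> \<le> (\<Sum>i\<in>I. r i x * (u + v))"
  proof (rule sum_mono)
    fix i assume i: "i \<in> I"
    show "\<bar>r i x * (f (\<sigma> i x) - f x)\<bar> \<le> r i x * (u + v)"
    proof (cases "r i x = 0")
      case False
      have "\<bar>f (\<sigma> i x) - f x\<bar> \<le> u + v" using u(2)[OF i False] v by linarith
      then show ?thesis using rate_nonneg[OF i x] by (simp add: abs_mult mult_left_mono)
    qed simp
  qed
  also have "\<dots> = (\<Sum>i\<in>I. r i x) * (u + v)" by (simp add: sum_distrib_right)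
  also have "\<dots> \<le> M * \<Phi> x * (u + v)" using rate_le[OF x] u(1) v by (intro mult_right_mono) auto
  finally show ?thesis .
qed

text \<open>\<open>A\<close> costs one factor \<Phi>, so this decay leaves \<open>A f\<close> of
  order 1/\<Phi> and \<open>A (A f)\<close> bounded, which is enough for a second-order expansion in
  time.\<close>

definition rapid :: "real \<Rightarrow> ('a \<Rightarrow> real) \<Rightarrow> bool" where
  "rapid c f \<longleftrightarrow> (\<forall>x\<in>X. \<bar>f x\<bar> \<le> c / (\<Phi> x)\<^sup>2)"

lemma inverse_Phi_jump:
  assumes "i \<in> I" "x \<in> X" "r i x \<noteq> 0"
  shows "1 / \<Phi> (\<sigma> i x) \<le> M / \<Phi> x"
  using Phi_jump[OF assms(1,2)] Phi_pos[OF assms(2)] Phi_pos[OF jump_in[OF assms]]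
  by (simp add: field_simps)

lemma A_rapid:
  assumes f: "rapid c f" and c: "0 \<le> c" and x: "x \<in> X"
  shows "\<bar>A f x\<bar> \<le> c * B / \<Phi> x"
proof -
  have "\<bar>A f x\<bar> \<le> M * \<Phi> x * (c * (M / \<Phi> x)\<^sup>2 + c / (\<Phi> x)\<^sup>2)"
  proof (rule A_bound[OF x])
    fix i assume i: "i \<in> I" "r i x \<noteq> 0"
    note j = jump_in[OF i(1) x i(2)]
    have "\<bar>f (\<sigma> i x)\<bar> \<le> c * (1 / \<Phi> (\<sigma> i x))\<^sup>2"
      using f j by (simp add: rapid_def power_divide)
    also have "\<dots> \<le> c * (M / \<Phi> x)\<^sup>2"
      using inverse_Phi_jump[OF i(1) x i(2)] c Phi_pos[OF j]
      by (intro mult_left_mono power_mono) auto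
    finally show "\<bar>f (\<sigma> i x)\<bar> \<le> c * (M / \<Phi> x)\<^sup>2" .
  qed (use f c x in \<open>auto simp: rapid_def\<close>)
  also have "\<dots> = c * B / \<Phi> x"
    using Phi_pos[OF x] by (simp add: B_def field_simps power2_eq_square)
  finally show ?thesis .
qed

lemma A_order_1:
  assumes f: "\<And>x. x \<in> X \<Longrightarrow> \<bar>f x\<bar> \<le> c / \<Phi> x" and c: "0 \<le> c" and x: "x \<in> X"
  shows "\<bar>A f x\<bar> \<le> c * B"
proof -
  have "\<bar>A f x\<bar> \<le> M * \<Phi> x * (c * (M / \<Phi> x) + c / \<Phi> x)"
  proof (rule A_bound[OF x])
    show "0 \<le> c * (M / \<Phi> x)" using c M_pos Phi_pos[OF x] by simp
    fix i assume i: "i \<in> I" "r i x \<noteq> 0"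
    note j = jump_in[OF i(1) x i(2)]
    have "\<bar>f (\<sigma> i x)\<bar> \<le> c * (1 / \<Phi> (\<sigma> i x))"
      using f[OF j] by simp
    also have "\<dots> \<le> c * (M / \<Phi> x)"
      using inverse_Phi_jump[OF i(1) x i(2)] c by (intro mult_left_mono) auto
    finally show "\<bar>f (\<sigma> i x)\<bar> \<le> c * (M / \<Phi> x)" .
  qed (use f x in auto)
  also have "\<dots> = c * (M * (M + 1))"
    using Phi_pos[OF x] by (simp add: field_simps)
  \<comment> \<open>Since \<open>M \<ge> 1\<close>, \<open>M + 1\<close> is at most
    \<open>M^2 + 1\<close>, so the constant of \<open>A_rapid\<close> can be reused.\<close>
  also have "\<dots> \<le> c * B"
    unfolding B_def using M_ge_1 c
    by (intro mult_left_mono) (auto simp: power2_eq_square)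
  finally show ?thesis .
qed

lemma A_order_0:
  assumes "rapid c f" and "0 \<le> c" and "x \<in> X"
  shows "\<bar>A f x\<bar> \<le> c * B"
proof -
  have "c * B / \<Phi> x \<le> c * B / 1"
    using assms Phi_ge_1[of x] B_pos by (intro divide_left_mono) auto
  then show ?thesis using A_rapid[OF assms] by simp
qed

text \<open>With \<open>u = \<Phi> x / \<Phi> (\<sigma> i x)\<close> and \<open>d = 1/u - 1\<close> one has
  \<open>u\<^sup>2 - 1 = - 2 d + u (u + 2) d\<^sup>2\<close>, so the drift of \<open>\<Phi>\<close> controls that of \<open>1 / \<Phi>\<^sup>2\<close>.\<close>
lemma A_inverse_square:
  assumes x: "x \<in> X"
  shows "A (\<lambda>x. 1 / (\<Phi> x)\<^sup>2) x \<le> C * (1 / (\<Phi> x)\<^sup>2)"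
proof -
  let ?d = "\<lambda>i. \<Phi> (\<sigma> i x) - \<Phi> x"
  note px = Phi_pos[OF x]
  have "A (\<lambda>x. 1 / (\<Phi> x)\<^sup>2) x
      \<le> (\<Sum>i\<in>I. (- 2 / (\<Phi> x)^3) * (r i x * ?d i) + r i x * (M\<^sup>2 * (M + 2) / (\<Phi> x)^3))"
    unfolding A_def
  proof (rule sum_mono)
    fix i assume i: "i \<in> I"
    show "r i x * (1 / (\<Phi> (\<sigma> i x))\<^sup>2 - 1 / (\<Phi> x)\<^sup>2)
      \<le> (- 2 / (\<Phi> x)^3) * (r i x * ?d i) + r i x * (M\<^sup>2 * (M + 2) / (\<Phi> x)^3)"
    proof (cases "r i x = 0")
      case False
      note py = Phi_pos[OF jump_in[OF i x False]]
      define u where "u = \<Phi> x / \<Phi> (\<sigma> i x)"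
      have u: "0 < u" "u \<le> M"
        using px py Phi_jump[OF i x] by (auto simp: u_def field_simps)
      have eq: "1 / (\<Phi> (\<sigma> i x))\<^sup>2 - 1 / (\<Phi> x)\<^sup>2
          = (- 2 / (\<Phi> x)^3) * ?d i + (u * (u + 2)) * (?d i)\<^sup>2 / (\<Phi> x)^4"
        using px py unfolding u_def by (simp add: field_simps) algebra
      have "(u * (u + 2)) * (?d i)\<^sup>2 \<le> (M * (M + 2)) * (M * \<Phi> x)"
        using u Phi_incr[OF i x] M_pos by (intro mult_mono) auto
      then have "(u * (u + 2)) * (?d i)\<^sup>2 / (\<Phi> x)^4 \<le> (M * (M + 2)) * (M * \<Phi> x) / (\<Phi> x)^4"
        using px by (intro divide_right_mono) auto
      also have "\<dots> = M\<^sup>2 * (M + 2) / (\<Phi> x)^3"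
        using px by (simp add: field_simps power2_eq_square eval_nat_numeral)
      finally have "1 / (\<Phi> (\<sigma> i x))\<^sup>2 - 1 / (\<Phi> x)\<^sup>2
          \<le> (- 2 / (\<Phi> x)^3) * ?d i + M\<^sup>2 * (M + 2) / (\<Phi> x)^3" using eq by simp
      from mult_left_mono[OF this rate_nonneg[OF i x]] show ?thesis
        by (simp only: distrib_left mult_ac)
    qed simp
  qed
  also have "\<dots> = (- 2 / (\<Phi> x)^3) * (\<Sum>i\<in>I. r i x * ?d i)
      + (\<Sum>i\<in>I. r i x) * (M\<^sup>2 * (M + 2) / (\<Phi> x)^3)"
    by (simp only: sum.distrib sum_distrib_left sum_distrib_right)
  also have "\<dots> \<le> (2 / (\<Phi> x)^3) * (M * \<Phi> x) + (M * \<Phi> x) * (M\<^sup>2 * (M + 2) / (\<Phi> x)^3)"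
  proof (rule add_mono)
    \<comment> \<open>The drift of \<Phi> carries a negative factor, so its lower bound is what
      counts here.\<close>
    have "(2 / (\<Phi> x)^3) * (- (\<Sum>i\<in>I. r i x * ?d i)) \<le> (2 / (\<Phi> x)^3) * (M * \<Phi> x)"
      using drift_le[OF x] px by (intro mult_left_mono) auto
    then show "(- 2 / (\<Phi> x)^3) * (\<Sum>i\<in>I. r i x * ?d i) \<le> (2 / (\<Phi> x)^3) * (M * \<Phi> x)" by simp
  qed (use rate_le[OF x] px M_pos in \<open>intro mult_right_mono, auto\<close>)
  also have "\<dots> = C * (1 / (\<Phi> x)\<^sup>2)"
    using px by (simp add: C_def field_simps power2_eq_square eval_nat_numeral)
  finally show ?thesis .
qed

lemma A_Phi: "x \<in> X \<Longrightarrow> A \<Phi> x \<le> C * \<Phi> x"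
proof -
  assume x: "x \<in> X"
  have "A \<Phi> x \<le> M * \<Phi> x" using drift_le[OF x] by (simp add: A_def)
  also have "\<dots> \<le> C * \<Phi> x" using C_ge Phi_pos[OF x] by simp
  finally show ?thesis .
qed

lemma order_1_vanishing:
  assumes "\<And>x. x \<in> X \<Longrightarrow> \<bar>f x\<bar> \<le> c / \<Phi> x"
  shows "f \<in> vanishing X"
  unfolding vanishing_def
proof (intro CollectI allI impI)
  fix e :: real assume e: "0 < e"
  have "{x \<in> X. e \<le> \<bar>f x\<bar>} \<subseteq> {x \<in> X. \<Phi> x \<le> c / e}"
  proof clarify
    fix x assume x: "x \<in> X" "e \<le> \<bar>f x\<bar>"
    then have "e \<le> c / \<Phi> x" using assms by force
    then show "\<Phi> x \<le> c / e" using e Phi_pos[OF x(1)] by (simp add: field_simps)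
  qed
  then show "finite {x \<in> X. e \<le> \<bar>f x\<bar>}" using finite_sublevel finite_subset by blast
qed

lemma rapid_order_1:
  assumes "rapid c f" "0 \<le> c" "x \<in> X"
  shows "\<bar>f x\<bar> \<le> c / \<Phi> x"
proof -
  have "\<Phi> x \<le> (\<Phi> x)\<^sup>2" using Phi_ge_1[OF assms(3)] by (simp add: power2_eq_square)
  then have "c / (\<Phi> x)\<^sup>2 \<le> c / \<Phi> x"
    using assms(2) Phi_pos[OF assms(3)] by (intro divide_left_mono) auto
  then show ?thesis using assms by (fastforce simp: rapid_def)
qed

lemma rapid_order_0:
  assumes "rapid c f" "0 \<le> c" "x \<in> X"
  shows "\<bar>f x\<bar> \<le> c"
proof -
  have "c / \<Phi> x \<le> c / 1"
    using assms Phi_ge_1[of x] by (intro divide_left_mono) auto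
  then show ?thesis using rapid_order_1[OF assms] by simp
qed

text \<open>The constant is crude; what matters is that truncations to finite sets, dense by
  \<open>vanishing_approx\<close>, belong to the rapid class.\<close>

lemma finite_support_rapid:
  assumes "finite F"
  obtains c where "0 \<le> c" "rapid c (\<lambda>x. f x * indicat_real F x)"
proof
  let ?c = "\<Sum>x\<in>F. \<bar>f x\<bar> * (\<Phi> x)\<^sup>2"
  show c: "0 \<le> ?c" by (intro sum_nonneg) auto
  show "rapid ?c (\<lambda>x. f x * indicat_real F x)"
    unfolding rapid_def
  proof
    fix x assume x: "x \<in> X"
    have "\<bar>f x\<bar> * (\<Phi> x)\<^sup>2 \<le> ?c" if "x \<in> F"
      using that assms by (intro member_le_sum[where f="\<lambda>x. \<bar>f x\<bar> * (\<Phi> x)\<^sup>2"]) auto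
    then show "\<bar>f x * indicat_real F x\<bar> \<le> ?c / (\<Phi> x)\<^sup>2"
      using Phi_pos[OF x] c by (cases "x \<in> F") (auto simp: field_simps)
  qed
qed

section \<open>Maximum principle and dissipativity of \<open>A\<close>\<close>

lemma maximum_principle:
  assumes f: "f \<in> vanishing X" and l: "0 < l" and c: "0 \<le> c"
    and le: "\<And>x. x \<in> X \<Longrightarrow> l * f x - A f x \<le> c" and x: "x \<in> X"
  shows "l * f x \<le> c"
proof (cases "f x \<le> 0")
  case True
  then show ?thesis using l c mult_nonneg_nonpos[of l "f x"] by linarith
next
  case False
  \<comment> \<open>As \<open>f x > 0\<close>, only finitely many points carry a value of at least
    \<open>f x\<close>, so the maximum of \<open>f\<close> is attained in \<open>?S\<close>. From
    there no jump of positive rate goes up, whence \<open>A f y \<le> 0\<close>.\<close>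
  let ?S = "{y \<in> X. f x \<le> f y}"
  have "?S \<subseteq> {y \<in> X. f x \<le> \<bar>f y\<bar>}" by auto
  moreover have "finite {y \<in> X. f x \<le> \<bar>f y\<bar>}" using f False by (auto simp: vanishing_def)
  ultimately have fin: "finite (f ` ?S)" using finite_subset by blast
  have "f x \<in> f ` ?S" using x by auto
  then have "Max (f ` ?S) \<in> f ` ?S" using fin Max_in by blast
  then obtain y where y: "y \<in> ?S" "f y = Max (f ` ?S)" by fastforce
  have max: "f z \<le> f y" if "z \<in> X" for z
  proof (cases "f x \<le> f z")
    case True
    then show ?thesis using fin that y(2) by simp
  next
    case False
    then show ?thesis using y(1) by simp
  qed
  have "A f y \<le> 0"
    unfolding A_def
  proof (rule sum_nonpos)
    fix i assume i: "i \<in> I"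
    show "r i y * (f (\<sigma> i y) - f y) \<le> 0"
    proof (cases "r i y = 0")
      case False
      then show ?thesis using max[OF jump_in[OF i _ False]] rate_nonneg[OF i] y(1)
        by (auto intro: mult_nonneg_nonpos)
    qed simp
  qed
  moreover have "l * f x \<le> l * f y" using y(1) l by simp
  ultimately show ?thesis using le[of y] y(1) by simp
qed

text \<open>The maximum principle is applied to \<open>f\<close> and to \<open>-f\<close>. No rate
  of decay enters, so \<open>rapid_core\<close> can compare any element of the maximal domain with a
  rapid function.\<close>

lemma dissipative:
  assumes f: "f \<in> vanishing X" and l: "0 < l"
    and le: "\<And>x. x \<in> X \<Longrightarrow> \<bar>l * f x - A f x\<bar> \<le> c" and x: "x \<in> X"
  shows "l * \<bar>f x\<bar> \<le> c"
proof -
  have c: "0 \<le> c" using le[OF x] by linarith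
  have 1: "l * f x \<le> c"
    by (rule maximum_principle[OF f l c _ x]) (use le in \<open>fastforce simp: abs_le_iff\<close>)
  have 2: "l * (-1 * f x) \<le> c"
  proof (rule maximum_principle[OF vanishing_scale[OF f] l c _ x])
    fix y assume "y \<in> X"
    have "A (\<lambda>x. -1 * f x) y = - A f y" using A_lin[of "-1" f 0 f y] by simp
    then show "l * (-1 * f y) - A (\<lambda>x. -1 * f x) y \<le> c" using le[OF \<open>y \<in> X\<close>] by simp
  qed
  show ?thesis using 1 2 l by (cases "0 \<le> f x") auto
qed

section \<open>One-step approximations\<close>

text \<open>One step of size \<open>h\<close> of a discrete-time Markov chain, frozen where the rates are too large
  for an Euler step to be positive.\<close>
definition K :: "real \<Rightarrow> ('a \<Rightarrow> real) \<Rightarrow> 'a \<Rightarrow> real" where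
  "K h f x = (if h * M * \<Phi> x \<le> 1 then f x + h * A f x else f x)"

lemma K_lin: "K h (\<lambda>x. a * f x + b * g x) = (\<lambda>x. a * K h f x + b * K h g x)"
  by (rule ext) (simp add: K_def A_lin algebra_simps)

lemma Kpow_lin: "(K h ^^ j) (\<lambda>x. a * f x + b * g x) = (\<lambda>x. a * (K h ^^ j) f x + b * (K h ^^ j) g x)"
  by (induction j) (simp_all add: K_lin)

lemma Kpow_diff: "(K h ^^ j) (\<lambda>x. f x - g x) x = (K h ^^ j) f x - (K h ^^ j) g x"
  using Kpow_lin[where a=1 and b="-1"] by (simp add: fun_eq_iff)

lemma Kpow_const: "(K h ^^ j) (\<lambda>_. c) = (\<lambda>_. c)"
  by (induction j) (simp_all add: K_def A_def fun_eq_iff)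

text \<open>Where the step is not frozen, \<open>rate_le\<close> and the threshold make
  \<open>K h f x\<close> a convex combination of \<open>f x\<close> and the values at the
  neighbours.\<close>

lemma K_mono:
  assumes h: "0 \<le> h" and le: "\<And>x. x \<in> X \<Longrightarrow> f x \<le> g x" and x: "x \<in> X"
  shows "K h f x \<le> K h g x"
proof (cases "h * M * \<Phi> x \<le> 1")
  case True
  have eq: "K h u x = (1 - h * (\<Sum>i\<in>I. r i x)) * u x + h * (\<Sum>i\<in>I. r i x * u (\<sigma> i x))" for u
    using True by (simp add: K_def A_def algebra_simps sum_subtractf sum_distrib_left)
  have "h * (\<Sum>i\<in>I. r i x) \<le> h * (M * \<Phi> x)" using rate_le[OF x] h by (intro mult_left_mono)
  then have "0 \<le> 1 - h * (\<Sum>i\<in>I. r i x)" using True by (simp add: mult.assoc)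
  moreover have "(\<Sum>i\<in>I. r i x * f (\<sigma> i x)) \<le> (\<Sum>i\<in>I. r i x * g (\<sigma> i x))"
  proof (rule sum_mono)
    fix i assume i: "i \<in> I"
    show "r i x * f (\<sigma> i x) \<le> r i x * g (\<sigma> i x)"
    proof (cases "r i x = 0")
      case False
      then show ?thesis using le[OF jump_in[OF i x False]] rate_nonneg[OF i x]
        by (intro mult_left_mono)
    qed simp
  qed
  ultimately show ?thesis unfolding eq using le[OF x] h by (intro add_mono mult_left_mono) auto
qed (simp add: K_def le[OF x])

lemma Kpow_mono:
  assumes h: "0 \<le> h" and le: "\<And>x. x \<in> X \<Longrightarrow> f x \<le> g x"
  shows "x \<in> X \<Longrightarrow> (K h ^^ j) f x \<le> (K h ^^ j) g x"
  by (induction j arbitrary: x) (simp_all add: le K_mono[OF h])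

lemma Kpow_abs:
  assumes h: "0 \<le> h" and le: "\<And>x. x \<in> X \<Longrightarrow> \<bar>f x\<bar> \<le> g x" and x: "x \<in> X"
  shows "\<bar>(K h ^^ j) f x\<bar> \<le> (K h ^^ j) g x"
proof -
  have "(K h ^^ j) f x \<le> (K h ^^ j) g x"
    using le by (intro Kpow_mono[OF h _ x]) (auto simp: abs_le_iff)
  \<comment> \<open>This is \<open>-f\<close>, spelled out as an instance of
    \<open>Kpow_lin\<close>.\<close>
  moreover have "(K h ^^ j) (\<lambda>x. - 1 * f x + 0 * f x) x \<le> (K h ^^ j) g x"
    using le by (intro Kpow_mono[OF h _ x]) (auto simp: abs_le_iff)
  ultimately show ?thesis unfolding Kpow_lin by simp
qed

lemma Kpow_contraction:
  assumes h: "0 \<le> h" and le: "\<And>x. x \<in> X \<Longrightarrow> \<bar>f x\<bar> \<le> c" and x: "x \<in> X"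
  shows "\<bar>(K h ^^ j) f x\<bar> \<le> c"
  using Kpow_abs[OF h, of f "\<lambda>_. c", OF le x] by (simp add: Kpow_const)

text \<open>At frozen points the factor \<open>1 + C * h \<ge> 1\<close> suffices. Iterated, the
  bound is used for two weights: 1/\<Phi>^2, which keeps functions vanishing at infinity, and
  \<Phi>, which prevents loss of mass.\<close>

lemma K_superharmonic:
  assumes h: "0 \<le> h" and w: "0 \<le> w x" and le: "A w x \<le> C * w x"
  shows "K h w x \<le> (1 + C * h) * w x"
proof -
  have "h * A w x \<le> h * (C * w x)" using le h by (rule mult_left_mono)
  moreover have "0 \<le> h * (C * w x)" using h w C_pos by simp
  ultimately show ?thesis by (simp add: K_def algebra_simps)
qed

lemma Kpow_superharmonic:
  assumes h: "0 \<le> h" and w: "\<And>x. x \<in> X \<Longrightarrow> 0 \<le> w x"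
    and le: "\<And>x. x \<in> X \<Longrightarrow> A w x \<le> C * w x"
  shows "x \<in> X \<Longrightarrow> (K h ^^ j) w x \<le> (1 + C * h)^j * w x"
proof (induction j arbitrary: x)
  case (Suc j)
  have "(K h ^^ Suc j) w x \<le> K h (\<lambda>x. (1 + C * h)^j * w x + 0 * w x) x"
    using Suc.IH by (auto intro!: K_mono[OF h _ Suc.prems])
  also have "\<dots> = (1 + C * h)^j * K h w x" unfolding K_lin by simp
  also have "\<dots> \<le> (1 + C * h)^j * ((1 + C * h) * w x)"
    using K_superharmonic[where w=w, OF h w[OF Suc.prems] le[OF Suc.prems]] h C_pos
    by (intro mult_left_mono) auto
  finally show ?case by (simp add: mult_ac)
qed simp

lemma Kpow_rapid:
  assumes h: "0 \<le> h" and f: "rapid c f" and c: "0 \<le> c"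
  shows "rapid (c * (1 + C * h)^j) ((K h ^^ j) f)"
  unfolding rapid_def
proof
  fix x assume x: "x \<in> X"
  have "\<bar>(K h ^^ j) f x\<bar> \<le> (K h ^^ j) (\<lambda>x. c * (1 / (\<Phi> x)\<^sup>2) + 0 * (1 / (\<Phi> x)\<^sup>2)) x"
    using f by (intro Kpow_abs[OF h _ x]) (auto simp: rapid_def)
  also have "\<dots> = c * (K h ^^ j) (\<lambda>x. 1 / (\<Phi> x)\<^sup>2) x" unfolding Kpow_lin by simp
  also have "\<dots> \<le> c * ((1 + C * h)^j * (1 / (\<Phi> x)\<^sup>2))"
    by (intro mult_left_mono Kpow_superharmonic h A_inverse_square x c) auto
  finally show "\<bar>(K h ^^ j) f x\<bar> \<le> c * (1 + C * h)^j / (\<Phi> x)\<^sup>2" by simp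
qed

lemma K_rapid:
  assumes h: "0 \<le> h" and f: "rapid c f" and c: "0 \<le> c"
  shows "rapid (c * (1 + C * h)) (K h f)"
  using Kpow_rapid[OF assms, of 1] by simp

text \<open>Freezing is harmless: at a frozen point \<open>h * M * \<Phi> x > 1\<close>, so the
  bound of order 1/\<Phi> on \<open>A f\<close> is already of order \<open>h\<close>, and the
  omitted term \<open>h * A f x\<close> is of order \<open>h^2\<close>. Elsewhere the error is
  zero.\<close>

lemma K_step:
  assumes h: "0 \<le> h" and f: "rapid c f" and c: "0 \<le> c" and x: "x \<in> X"
  shows "\<bar>K h f x - f x - h * A f x\<bar> \<le> c * B * M * h\<^sup>2"
proof (cases "h * M * \<Phi> x \<le> 1")
  case True
  then show ?thesis using c h B_pos M_pos by (simp add: K_def)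
next
  case False
  have "h * \<bar>A f x\<bar> \<le> h * (c * B / \<Phi> x)" using A_rapid[OF f c x] h by (rule mult_left_mono)
  also have "\<dots> \<le> (h * (c * B / \<Phi> x)) * (h * M * \<Phi> x)"
    using False h c B_pos Phi_pos[OF x] mult_left_mono[of 1 "h * M * \<Phi> x" "h * (c * B / \<Phi> x)"] by simp
  also have "\<dots> = c * B * M * h\<^sup>2" using Phi_pos[OF x] by (simp add: power2_eq_square)
  finally show ?thesis using False h by (simp add: K_def abs_mult)
qed

text \<open>The increments telescope, and each is a contraction applied to \<open>K h g - g\<close>,
  whose size is at most \<open>h * d\<close>.\<close>

lemma Kpow_small:
  assumes h: "0 \<le> h" and g: "\<And>x. x \<in> X \<Longrightarrow> \<bar>A g x\<bar> \<le> d" and x: "x \<in> X"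
  shows "\<bar>(K h ^^ j) g x - g x\<bar> \<le> j * h * d"
proof (induction j)
  case (Suc j)
  have "\<bar>(K h ^^ j) (\<lambda>x. K h g x - g x) x\<bar> \<le> h * d"
  proof (rule Kpow_contraction[OF h _ x])
    fix y assume y: "y \<in> X"
    have "\<bar>h * A g y\<bar> \<le> h * d" using g[OF y] h by (simp add: abs_mult mult_left_mono)
    moreover have "0 \<le> h * d" using g[OF y] h by (simp add: mult_nonneg_nonneg)
    ultimately show "\<bar>K h g y - g y\<bar> \<le> h * d" by (simp add: K_def)
  qed
  then have "\<bar>(K h ^^ Suc j) g x - (K h ^^ j) g x\<bar> \<le> h * d"
    by (simp add: Kpow_diff funpow_Suc_right del: funpow.simps)
  then show ?case using Suc.IH by (simp add: algebra_simps)
qed simp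

text \<open>\<open>A f\<close> is compared with a function \<open>g\<close> of the user's choice
  because the bound \<open>d\<close> on \<open>A g\<close> must be controllable: in
  \<open>generator_if\<close> the function \<open>f\<close> varies over approximations of one
  element of the domain while \<open>g\<close> and \<open>d\<close> stay fixed.\<close>

lemma Kpow_taylor:
  assumes h: "0 \<le> h" and f: "rapid c f" and c: "0 \<le> c"
    and fg: "\<And>x. x \<in> X \<Longrightarrow> \<bar>A f x - g x\<bar> \<le> \<delta>"
    and g: "\<And>x. x \<in> X \<Longrightarrow> \<bar>A g x\<bar> \<le> d" and x: "x \<in> X"
  shows "\<bar>(K h ^^ j) f x - f x - j * h * A f x\<bar> \<le> j * h * (2 * \<delta> + j * h * d + c * B * M * h)"
proof (induction j)
  case (Suc j)
  define e where "e = (\<lambda>x. K h f x - f x - h * A f x)"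
  have d: "0 \<le> d" using g[OF x] by linarith
  have 1: "\<bar>(K h ^^ j) e x\<bar> \<le> c * B * M * h\<^sup>2"
    unfolding e_def by (rule Kpow_contraction[OF h K_step[OF h f c] x])
  have 2: "\<bar>(K h ^^ j) (\<lambda>x. A f x - g x) x\<bar> \<le> \<delta>"
    by (rule Kpow_contraction[OF h fg x])
  \<comment> \<open>Passing from \<open>A f\<close> to \<open>g\<close> costs \<delta> both before
    and after applying the powers of \<open>K h\<close>, hence \<open>2 * \<delta>\<close>.\<close>
  have 3: "\<bar>(K h ^^ j) (A f) x - A f x\<bar> \<le> 2 * \<delta> + j * h * d"
    using 2 fg[OF x] Kpow_small[OF h g x, of j] unfolding Kpow_diff by linarith
  have "(K h ^^ Suc j) f x - (K h ^^ j) f x = (K h ^^ j) (\<lambda>x. K h f x - f x) x"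
    by (simp add: Kpow_diff funpow_Suc_right del: funpow.simps)
  also have "(\<lambda>x. K h f x - f x) = (\<lambda>x. 1 * e x + h * A f x)" by (simp add: e_def)
  also have "(K h ^^ j) \<dots> x = (K h ^^ j) e x + h * (K h ^^ j) (A f) x"
    unfolding Kpow_lin by simp
  finally have 4: "(K h ^^ Suc j) f x - (K h ^^ j) f x - h * A f x
      = (K h ^^ j) e x + h * ((K h ^^ j) (A f) x - A f x)" by (simp add: algebra_simps)
  have "\<bar>h * ((K h ^^ j) (A f) x - A f x)\<bar> \<le> h * (2 * \<delta> + j * h * d)"
    using 3 h by (simp add: abs_mult mult_left_mono)
  with 1 have 5: "\<bar>(K h ^^ Suc j) f x - (K h ^^ j) f x - h * A f x\<bar>
      \<le> c * B * M * h\<^sup>2 + h * (2 * \<delta> + j * h * d)" unfolding 4 by linarith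
  have 6: "\<bar>(K h ^^ Suc j) f x - f x - Suc j * h * A f x\<bar>
    \<le> \<bar>(K h ^^ j) f x - f x - j * h * A f x\<bar> + \<bar>(K h ^^ Suc j) f x - (K h ^^ j) f x - h * A f x\<bar>"
    by (simp add: algebra_simps del: funpow.simps)
  have 7: "j * h * (2 * \<delta> + j * h * d + c * B * M * h) + (c * B * M * h\<^sup>2 + h * (2 * \<delta> + j * h * d))
      \<le> Suc j * h * (2 * \<delta> + Suc j * h * d + c * B * M * h)"
    using h d by (simp add: algebra_simps power2_eq_square)
  show ?case using 5 6 7 Suc.IH by linarith
qed simp

section \<open>Comparison of step sizes h and 2h\<close>

definition "B' = (1 + C) * B * M + 5 * B * M + B\<^sup>2"

lemma B'_nonneg: "0 \<le> B'"
  using B_pos C_pos M_pos unfolding B'_def by (intro add_nonneg_nonneg mult_nonneg_nonneg) auto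

text \<open>Both sides equal \<open>f x + 2 * h * A f x\<close> up to order \<open>h^2\<close>. In
  the second small step \<open>A (K h f)\<close> has to be replaced by \<open>A f\<close>, which is
  possible because \<open>K h f - f\<close> is of order h/\<Phi> and \<open>A_order_1\<close>
  applies.\<close>

lemma K_consistency:
  assumes h: "0 \<le> h" "h \<le> 1" and f: "rapid c f" and c: "0 \<le> c" and x: "x \<in> X"
  shows "\<bar>K h (K h f) x - K (2 * h) f x\<bar> \<le> c * B' * h\<^sup>2"
proof -
  let ?f = "K h f"
  have 1: "\<bar>K h ?f x - ?f x - h * A ?f x\<bar> \<le> (c * (1 + C * h)) * B * M * h\<^sup>2"
    using h c C_pos by (intro K_step K_rapid f x) auto
  have "(c * (1 + C * h)) * (B * M * h\<^sup>2) \<le> (c * (1 + C)) * (B * M * h\<^sup>2)"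
    using h c C_pos B_pos M_pos by (intro mult_right_mono mult_left_mono) auto
  with 1 have 1: "\<bar>K h ?f x - ?f x - h * A ?f x\<bar> \<le> (c * (1 + C)) * (B * M * h\<^sup>2)"
    by (simp add: mult.assoc)
  have 2: "\<bar>?f x - f x - h * A f x\<bar> \<le> c * B * M * h\<^sup>2"
    by (rule K_step[OF h(1) f c x])
  have "\<bar>A (\<lambda>x. ?f x - f x) x\<bar> \<le> (h * c * B) * B"
  proof (rule A_order_1[OF _ _ x])
    fix y assume y: "y \<in> X"
    have "h * \<bar>A f y\<bar> \<le> h * (c * B / \<Phi> y)" using A_rapid[OF f c y] h(1) by (rule mult_left_mono)
    moreover have "0 \<le> h * (c * B / \<Phi> y)" using h c B_pos Phi_pos[OF y] by simp
    ultimately show "\<bar>?f y - f y\<bar> \<le> h * c * B / \<Phi> y" using h by (simp add: K_def abs_mult)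
  qed (use h c B_pos in auto)
  then have 3: "\<bar>h * A (\<lambda>x. ?f x - f x) x\<bar> \<le> h * ((h * c * B) * B)"
    using h by (simp add: abs_mult mult_left_mono)
  have 4: "\<bar>K (2 * h) f x - f x - (2 * h) * A f x\<bar> \<le> c * B * M * (2 * h)\<^sup>2"
    using h by (intro K_step f c x) auto
  have eq: "h * A (\<lambda>x. ?f x - f x) x = h * A ?f x - h * A f x"
    by (simp add: A_diff algebra_simps)
  \<comment> \<open>The four errors explain \<open>B'\<close>: \<open>(1 + C) * B * M\<close> from
    the second small step, \<open>B * M\<close> from the first, \<open>B^2\<close> from the
    replacement, and \<open>4 * B * M\<close> from the step of size \<open>2 * h\<close>.\<close>
  have "\<bar>K h ?f x - K (2 * h) f x\<bar> \<le>
      (c * (1 + C)) * (B * M * h\<^sup>2) + c * B * M * h\<^sup>2 + h * ((h * c * B) * B) + c * B * M * (2 * h)\<^sup>2"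
    using 1 2 3 4 unfolding eq by linarith
  also have "\<dots> = c * B' * h\<^sup>2"
    by (simp add: B'_def algebra_simps power2_eq_square)
  finally show ?thesis .
qed

text \<open>Consistency and stability: one large step is peeled off on the side of \<open>f\<close>,
  its defect is carried along by a contraction, and the induction continues with
  \<open>K (2 * h) f\<close>. This is why \<open>c\<close> and \<open>f\<close> vary: the constant
  grows by \<open>1 + C * (2 * h)\<close> at each step.\<close>

lemma Kpow_consistency:
  assumes h: "0 \<le> h" "h \<le> 1"
  shows "rapid c f \<Longrightarrow> 0 \<le> c \<Longrightarrow> x \<in> X \<Longrightarrow>
    \<bar>(K h ^^ (2 * j)) f x - (K (2 * h) ^^ j) f x\<bar> \<le> j * (c * (1 + C * (2 * h))^j * B' * h\<^sup>2)"
proof (induction j arbitrary: c f)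
  case (Suc j)
  let ?q = "1 + C * (2 * h)"
  have q: "1 \<le> ?q" using h C_pos by simp
  have "\<bar>(K h ^^ (2 * j)) (\<lambda>x. K h (K h f) x - K (2 * h) f x) x\<bar> \<le> c * B' * h\<^sup>2"
    by (rule Kpow_contraction[OF h(1) K_consistency[OF h Suc.prems(1,2)] Suc.prems(3)])
  moreover have "(K h ^^ (2 * Suc j)) f = (K h ^^ (2 * j)) (K h (K h f))"
    by (simp add: funpow_Suc_right del: funpow.simps)
  ultimately have 1: "\<bar>(K h ^^ (2 * Suc j)) f x - (K h ^^ (2 * j)) (K (2 * h) f) x\<bar> \<le> c * B' * h\<^sup>2"
    by (simp add: Kpow_diff)
  have 2: "\<bar>(K h ^^ (2 * j)) (K (2 * h) f) x - (K (2 * h) ^^ Suc j) f x\<bar>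
      \<le> j * ((c * ?q) * ?q^j * B' * h\<^sup>2)"
    unfolding funpow_Suc_right comp_def
    using h q Suc.prems by (intro Suc.IH K_rapid) auto
  have "c * B' * h\<^sup>2 * 1 \<le> c * B' * h\<^sup>2 * ?q ^ Suc j"
    using Suc.prems(2) B'_nonneg one_le_power[OF q] by (intro mult_left_mono) (auto simp del: power_Suc)
  then have 3: "c * B' * h\<^sup>2 + j * ((c * ?q) * ?q^j * B' * h\<^sup>2)
      \<le> Suc j * (c * ?q ^ Suc j * B' * h\<^sup>2)" by (simp add: algebra_simps)
  from 1 2 3 show ?case by linarith
qed simp

section \<open>Approximate resolvent and a core of rapid functions\<close>

text \<open>A fixed point of \<open>f = (h u + K h f) / (1 + l h)\<close> solves the resolvent equation
  \<open>l f - A f = u\<close> up to \<open>O(h)\<close>; the choice \<open>l = C + 1\<close> makes the iteration preserve the bound on \<open>u\<close>.\<close>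
lemma approximate_resolvent:
  assumes u: "rapid c u" and c: "0 \<le> c" and e: "0 < e"
  obtains f where "rapid c f" "\<And>x. x \<in> X \<Longrightarrow> \<bar>(C + 1) * f x - A f x - u x\<bar> \<le> e"
proof -
  \<comment> \<open>The error \<open>c * B * M * h\<close> of one step, after division by
    \<open>h\<close>, takes half of the tolerance.\<close>
  define h where "h = e / (2 * (c * B * M + 1))"
  have cBM: "0 \<le> c * B * M" using c B_pos M_pos by simp
  have h: "0 < h" using e cBM by (simp add: h_def)
  have hb: "c * B * M * h \<le> e / 2"
    using e cBM by (simp add: h_def field_simps)
  define q where "q = 1 + (C + 1) * h"
  have q: "1 < q" using h C_pos by (simp add: q_def)
  define F where "F J = ((\<lambda>f x. (h * u x + K h f x) / q) ^^ J) (\<lambda>_. 0)" for J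
  have F_Suc: "F (Suc J) = (\<lambda>x. (h * u x + K h (F J) x) / q)" for J by (simp add: F_def)
  have F_rapid: "rapid c (F J)" for J
  proof (induction J)
    case 0
    then show ?case using c by (simp add: F_def rapid_def)
  next
    case (Suc J)
    show ?case unfolding rapid_def
    proof
      fix x assume x: "x \<in> X"
      have "\<bar>h * u x\<bar> \<le> h * (c / (\<Phi> x)\<^sup>2)"
        using u x h unfolding rapid_def abs_mult by (intro mult_mono) auto
      moreover have "\<bar>K h (F J) x\<bar> \<le> c * (1 + C * h) / (\<Phi> x)\<^sup>2"
        using K_rapid[OF _ Suc c, of h] h x by (simp add: rapid_def)
      ultimately have "\<bar>h * u x + K h (F J) x\<bar> \<le> h * (c / (\<Phi> x)\<^sup>2) + c * (1 + C * h) / (\<Phi> x)\<^sup>2"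
        by linarith
      \<comment> \<open>Here \<open>h + (1 + C * h) = q\<close>: the source and the growth of
        \<open>K h\<close> together are exactly offset by the division by \<open>q\<close>.\<close>
      also have "\<dots> = q * (c / (\<Phi> x)\<^sup>2)" by (simp add: q_def algebra_simps add_divide_distrib)
      finally show "\<bar>F (Suc J) x\<bar> \<le> c / (\<Phi> x)\<^sup>2"
        using q by (simp add: F_Suc field_simps)
    qed
  qed
  have F_diff: "\<bar>F (Suc J) x - F J x\<bar> \<le> c * (1 / q)^J" if "x \<in> X" for J x
    using that
  proof (induction J arbitrary: x)
    case 0
    then show ?case using rapid_order_0[OF F_rapid[of 1] c 0] by (simp add: F_def)
  next
    case (Suc J)
    have "\<bar>(K h ^^ 1) (\<lambda>x. F (Suc J) x - F J x) x\<bar> \<le> c * (1 / q)^J"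
      using h by (intro Kpow_contraction Suc) auto
    then have "\<bar>K h (F (Suc J)) x - K h (F J) x\<bar> \<le> c * (1 / q)^J"
      unfolding Kpow_diff by simp
    moreover have "F (Suc (Suc J)) x - F (Suc J) x = (K h (F (Suc J)) x - K h (F J) x) / q"
      unfolding F_Suc[of "Suc J"] F_Suc[of J] by (simp add: diff_divide_distrib[symmetric])
    ultimately show ?case using q by (simp add: divide_right_mono)
  qed
  have "\<bar>1 / q\<bar> < 1" using q by (simp add: abs_of_pos)
  then have "(\<lambda>J. (1 / q)^J) \<longlonglongrightarrow> 0" by (intro LIMSEQ_power_zero) simp
  then have "(\<lambda>J. q * (c * (1 / q)^J) / h) \<longlonglongrightarrow> q * (c * 0) / h"
    by (intro tendsto_divide tendsto_mult tendsto_const) (use h in auto)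
  then have "eventually (\<lambda>J. q * (c * (1 / q)^J) / h < e / 2) sequentially"
    using e by (intro order_tendstoD) auto
  \<comment> \<open>A finite iterate suffices: the defect
    \<open>q * (F J x - F (Suc J) x) / h\<close> of the fixed point equation takes the other half of
    the tolerance.\<close>
  then obtain J where J: "q * (c * (1 / q)^J) / h < e / 2" by (auto dest: eventually_happens)
  show thesis
  proof (rule that[OF F_rapid[of J]])
    fix x assume x: "x \<in> X"
    have s: "\<bar>K h (F J) x - F J x - h * A (F J) x\<bar> \<le> c * B * M * h\<^sup>2"
      using h by (intro K_step F_rapid c x) auto
    have "q * F (Suc J) x = h * u x + K h (F J) x" using q by (simp add: F_Suc)
    then have "h * ((C + 1) * F J x - A (F J) x - u x)
      = q * (F J x - F (Suc J) x) + (K h (F J) x - F J x - h * A (F J) x)"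
      by (simp add: q_def algebra_simps)
    moreover have "\<bar>q * (F J x - F (Suc J) x)\<bar> \<le> q * (c * (1 / q)^J)"
      using F_diff[OF x, of J] q by (simp add: abs_mult abs_minus_commute)
    ultimately have "\<bar>h * ((C + 1) * F J x - A (F J) x - u x)\<bar>
        \<le> q * (c * (1 / q)^J) + c * B * M * h\<^sup>2" using s by linarith
    then have "h * \<bar>(C + 1) * F J x - A (F J) x - u x\<bar> \<le> h * (q * (c * (1 / q)^J) / h + c * B * M * h)"
      using h unfolding abs_mult distrib_left by (simp add: power2_eq_square mult_ac)
    then have "\<bar>(C + 1) * F J x - A (F J) x - u x\<bar> \<le> q * (c * (1 / q)^J) / h + c * B * M * h"
      using h by simp
    then show "\<bar>(C + 1) * F J x - A (F J) x - u x\<bar> \<le> e" using J hb by linarith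
  qed
qed

text \<open>With \<open>u = (C + 1) * f - A f\<close> truncated to a finite set, the approximate
  resolvent yields a rapid \<open>g\<close> whose image under \<open>(C + 1) - A\<close> is close to
  that of \<open>f\<close>. Dissipativity makes \<open>g\<close> close to \<open>f\<close>, and
  subtraction makes \<open>A g\<close> close to \<open>A f\<close>.\<close>

lemma rapid_core:
  assumes f: "f \<in> vanishing X" and Af: "A f \<in> vanishing X" and e: "0 < e"
  obtains c g where "0 \<le> c" "rapid c g" "\<And>x. x \<in> X \<Longrightarrow> \<bar>f x - g x\<bar> \<le> e"
    "\<And>x. x \<in> X \<Longrightarrow> \<bar>A f x - A g x\<bar> \<le> e"
proof -
  define u where "u x = (C + 1) * f x - A f x" for x
  have "u \<in> vanishing X" unfolding u_def by (intro vanishing_diff vanishing_scale f Af)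
  then obtain F where F: "finite F"
    "\<And>x. x \<in> X \<Longrightarrow> \<bar>u x - u x * indicat_real F x\<bar> \<le> e / 4"
    using vanishing_approx[of u X "e/4"] e by (metis divide_pos_pos order_refl zero_less_numeral)
  obtain c where c: "0 \<le> c" "rapid c (\<lambda>x. u x * indicat_real F x)"
    using finite_support_rapid[OF F(1)] .
  obtain g where g: "rapid c g"
    "\<And>x. x \<in> X \<Longrightarrow> \<bar>(C + 1) * g x - A g x - u x * indicat_real F x\<bar> \<le> e / 4"
    using approximate_resolvent[OF c(2,1), of "e/4"] e by auto
  have gv: "g \<in> vanishing X" using rapid_order_1[OF g(1) c(1)] by (rule order_1_vanishing)
  have d: "\<bar>(C + 1) * (f x - g x) - A (\<lambda>x. f x - g x) x\<bar> \<le> e / 2" if x: "x \<in> X" for x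
    proof -
    have "(C + 1) * (f x - g x) - A (\<lambda>x. f x - g x) x = u x - ((C + 1) * g x - A g x)"
      by (simp add: A_diff u_def algebra_simps)
    then show ?thesis using F(2)[OF x] g(2)[OF x] by linarith
  qed
  have fg: "(C + 1) * \<bar>f x - g x\<bar> \<le> e / 2" if x: "x \<in> X" for x
    using C_pos by (intro dissipative[OF vanishing_diff[OF f gv] _ d x]) auto
  show thesis
  proof (rule that[OF c(1) g(1)])
    fix x assume x: "x \<in> X"
    have "1 * \<bar>f x - g x\<bar> \<le> (C + 1) * \<bar>f x - g x\<bar>" using C_pos by (intro mult_right_mono) auto
    then show "\<bar>f x - g x\<bar> \<le> e" using fg[OF x] e by simp
    have "\<bar>(C + 1) * (f x - g x)\<bar> \<le> e / 2" using fg[OF x] C_pos by (simp add: abs_mult)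
    then show "\<bar>A f x - A g x\<bar> \<le> e" using d[OF x] unfolding A_diff by linarith
  qed
qed

section \<open>The limit semigroup\<close>

text \<open>Dyadic step sizes make each level split every step of the previous one into two, the
  situation of \<open>Kpow_consistency\<close>.\<close>

definition E :: "nat \<Rightarrow> real \<Rightarrow> ('a \<Rightarrow> real) \<Rightarrow> 'a \<Rightarrow> real" where
  "E n t = K ((1/2)^n) ^^ nat \<lfloor>t * 2^n\<rfloor>"

text \<open>\<open>E_tendsto\<close> secures the limit for \<open>t \<ge> 0\<close>, vanishing
  \<open>f\<close> and points of \<open>X\<close>. Constants need not vanish at infinity and \<Phi>
  may be unbounded, so comparisons with them are made for \<open>E\<close> before passing to the
  limit.\<close>

definition P :: "real \<Rightarrow> ('a \<Rightarrow> real) \<Rightarrow> 'a \<Rightarrow> real" where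
  "P t f x = lim (\<lambda>n. E n t f x)"

lemma steps_le: "0 \<le> t \<Longrightarrow> real (nat \<lfloor>t * 2^n\<rfloor>) * (1/2)^n \<le> t"
  and steps_ge: "0 \<le> t \<Longrightarrow> t - (1/2)^n \<le> real (nat \<lfloor>t * 2^n\<rfloor>) * (1/2)^n"
proof -
  assume t: "0 \<le> t"
  then have eq: "real (nat \<lfloor>t * 2^n\<rfloor>) = of_int \<lfloor>t * 2^n\<rfloor>" by simp
  have "real (nat \<lfloor>t * 2^n\<rfloor>) * (1/2)^n \<le> (t * 2^n) * (1/2)^n"
    unfolding eq by (intro mult_right_mono of_int_floor_le) simp
  then show "real (nat \<lfloor>t * 2^n\<rfloor>) * (1/2)^n \<le> t" by (simp add: power_one_over)
  have "(t * 2^n - 1) * (1/2)^n \<le> real (nat \<lfloor>t * 2^n\<rfloor>) * (1/2)^n"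
    unfolding eq by (intro mult_right_mono) (linarith, simp)
  then show "t - (1/2)^n \<le> real (nat \<lfloor>t * 2^n\<rfloor>) * (1/2)^n"
    by (simp add: power_one_over algebra_simps)
qed

lemma half_power_tendsto: "(\<lambda>n. (1/2::real)^n) \<longlonglongrightarrow> 0"
  by (intro LIMSEQ_power_zero) auto

lemma steps_tendsto:
  assumes "0 \<le> t"
  shows "(\<lambda>n. real (nat \<lfloor>t * 2^n\<rfloor>) * (1/2)^n) \<longlonglongrightarrow> t"
proof (rule tendsto_sandwich[where f="\<lambda>n. t - (1/2)^n" and h="\<lambda>_. t"])
  show "(\<lambda>n. t - (1/2)^n) \<longlonglongrightarrow> t"
    using tendsto_diff[OF tendsto_const half_power_tendsto, of t] by simp
qed (use steps_le steps_ge assms in auto)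

lemma growth_le:
  assumes "0 \<le> t"
  shows "(1 + C * (1/2)^n) ^ nat \<lfloor>t * 2^n\<rfloor> \<le> exp (C * t)"
proof -
  let ?j = "nat \<lfloor>t * 2^n\<rfloor>"
  have "(1 + C * (1/2)^n) ^ ?j \<le> exp (C * (1/2)^n) ^ ?j"
    using C_pos exp_ge_add_one_self[of "C * (1/2)^n"] by (intro power_mono) auto
  also have "\<dots> = exp (C * (?j * (1/2)^n))" by (simp add: exp_of_nat_mult[symmetric] mult_ac)
  also have "\<dots> \<le> exp (C * t)" using C_pos steps_le[OF assms, of n] by simp
  finally show ?thesis .
qed

lemma E_contraction: "(\<And>x. x \<in> X \<Longrightarrow> \<bar>f x\<bar> \<le> c) \<Longrightarrow> x \<in> X \<Longrightarrow> \<bar>E n t f x\<bar> \<le> c"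
  unfolding E_def by (rule Kpow_contraction) auto

lemma E_lin: "E n t (\<lambda>x. a * f x + b * g x) x = a * E n t f x + b * E n t g x"
  unfolding E_def by (simp add: Kpow_lin)

lemma E_diff: "E n t (\<lambda>x. f x - g x) x = E n t f x - E n t g x"
  unfolding E_def by (rule Kpow_diff)

lemma E_approx:
  assumes "\<And>x. x \<in> X \<Longrightarrow> \<bar>f x - g x\<bar> \<le> e" "x \<in> X"
  shows "\<bar>E n t f x - E n t g x\<bar> \<le> e"
  using E_contraction[of "\<lambda>x. f x - g x" e x n t] assms by (simp add: E_diff)

lemma E_rapid:
  assumes "0 \<le> t" "rapid c f" "0 \<le> c" "x \<in> X"
  shows "\<bar>E n t f x\<bar> \<le> c * exp (C * t) / (\<Phi> x)\<^sup>2"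
proof -
  have "\<bar>E n t f x\<bar> \<le> c * (1 + C * (1/2)^n) ^ nat \<lfloor>t * 2^n\<rfloor> / (\<Phi> x)\<^sup>2"
    using Kpow_rapid[OF _ assms(2,3), of "(1/2)^n"] assms(4) by (simp add: E_def rapid_def)
  also have "\<dots> \<le> c * exp (C * t) / (\<Phi> x)\<^sup>2"
    using growth_le[OF assms(1)] assms(3) by (intro divide_right_mono mult_left_mono) auto
  finally show ?thesis .
qed

lemma E_Suc:
  assumes t: "0 \<le> t" and f: "rapid c f" and c: "0 \<le> c" and x: "x \<in> X"
  shows "\<bar>E (Suc n) t f x - E n t f x\<bar> \<le> (c * B + t * c * exp (C * t) * B') * (1/2)^n"
proof -
  define h :: real where "h = (1/2)^Suc n"
  define j where "j = nat \<lfloor>t * 2^n\<rfloor>"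
  have h: "0 \<le> h" "h \<le> 1" "2 * h = (1/2)^n"
    unfolding h_def by (simp_all add: power_le_one del: power_Suc) simp
  \<comment> \<open>Halving the step doubles the number of steps up to a possible extra one, the
    \<open>d\<close> below.\<close>
  have fl: "\<lfloor>2 * (t * 2^n)\<rfloor> = 2 * \<lfloor>t * 2^n\<rfloor> \<or> \<lfloor>2 * (t * 2^n)\<rfloor> = 2 * \<lfloor>t * 2^n\<rfloor> + 1"
    by linarith
  have nn: "0 \<le> \<lfloor>t * 2^n\<rfloor>" using t by simp
  obtain d where d: "d \<le> 1" "nat \<lfloor>t * 2^Suc n\<rfloor> = 2 * j + d"
  proof -
    have eq: "t * 2^Suc n = 2 * (t * 2^n)" by simp
    from fl nn have "nat \<lfloor>t * 2^Suc n\<rfloor> = 2 * j + 0 \<or> nat \<lfloor>t * 2^Suc n\<rfloor> = 2 * j + 1"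
      unfolding j_def eq by linarith
    then show thesis using that[of 0] that[of 1] by auto
  qed
  \<comment> \<open>The extra step acts on \<open>f\<close> first, so its effect is small by
    \<open>Kpow_small\<close> and stays small by contraction.\<close>
  have "\<bar>(K h ^^ (2 * j)) (\<lambda>x. (K h ^^ d) f x - f x) x\<bar> \<le> h * (c * B)"
  proof (rule Kpow_contraction[OF h(1) _ x])
    fix y assume "y \<in> X"
    have "\<bar>(K h ^^ d) f y - f y\<bar> \<le> d * h * (c * B)"
      by (rule Kpow_small[OF h(1) A_order_0[OF f c] \<open>y \<in> X\<close>])
    also have "\<dots> \<le> 1 * h * (c * B)" using d(1) h c B_pos by (intro mult_right_mono) auto
    finally show "\<bar>(K h ^^ d) f y - f y\<bar> \<le> h * (c * B)" by simp
  qed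
  then have 1: "\<bar>E (Suc n) t f x - (K h ^^ (2 * j)) f x\<bar> \<le> h * (c * B)"
    unfolding Kpow_diff E_def d(2) h_def funpow_add by (simp del: power_Suc)
  have "\<bar>(K h ^^ (2 * j)) f x - (K (2 * h) ^^ j) f x\<bar> \<le> j * (c * (1 + C * (2 * h))^j * B' * h\<^sup>2)"
    by (rule Kpow_consistency[OF h(1,2) f c x])
  then have 2: "\<bar>(K h ^^ (2 * j)) f x - E n t f x\<bar> \<le> j * (c * (1 + C * (2 * h))^j * B' * h\<^sup>2)"
    unfolding E_def j_def h(3) .
  \<comment> \<open>The number of steps is absorbed by one factor \<open>2 * h\<close>, as
    \<open>j * (2 * h) \<le> t\<close>; one power of \<open>h\<close> remains, so the errors are
    summable over the levels.\<close>
  have "j * (c * (1 + C * (2 * h))^j * B' * h\<^sup>2)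
      = (j * (2 * h)) * (c * (1 + C * (2 * h))^j * B') * (h / 2)"
    by (simp add: power2_eq_square)
  also have "\<dots> \<le> t * (c * exp (C * t) * B') * (2 * h)"
  proof (intro mult_mono)
    show "j * (2 * h) \<le> t" using steps_le[OF t] by (simp add: h(3) j_def)
    show "(1 + C * (2 * h))^j \<le> exp (C * t)" using growth_le[OF t] by (simp add: h(3) j_def)
  qed (use h c t B'_nonneg C_pos in auto)
  finally have 3: "j * (c * (1 + C * (2 * h))^j * B' * h\<^sup>2) \<le> t * (c * exp (C * t) * B') * (2 * h)" .
  have 4: "h * (c * B) \<le> (2 * h) * (c * B)" using h c B_pos by (intro mult_right_mono) auto
  have "(c * B + t * c * exp (C * t) * B') * (1/2)^n
      = (2 * h) * (c * B) + t * (c * exp (C * t) * B') * (2 * h)"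
    unfolding h(3)[symmetric] by (simp add: algebra_simps)
  then show ?thesis using 1 2 3 4 by linarith
qed

text \<open>The geometric series is summed exactly; keeping the difference of the two powers lets
  the induction on \<open>m\<close> close.\<close>

lemma E_Cauchy_rapid:
  assumes "0 \<le> t" "rapid c f" "0 \<le> c" "x \<in> X" "n \<le> m"
  shows "\<bar>E m t f x - E n t f x\<bar> \<le> 2 * (c * B + t * c * exp (C * t) * B') * ((1/2)^n - (1/2)^m)"
  using assms(5)
proof (induction m rule: dec_induct)
  case (step m)
  have "(1/2::real)^m = 2 * ((1/2)^m - (1/2)^Suc m)" by simp
  then have "\<bar>E (Suc m) t f x - E m t f x\<bar>
      \<le> (c * B + t * c * exp (C * t) * B') * (2 * ((1/2)^m - (1/2)^Suc m))"
    using E_Suc[OF assms(1-4), of m] by metis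
  then show ?case using step.IH by (simp add: algebra_simps del: power_Suc)
qed simp

lemma E_uniformly_Cauchy:
  assumes t: "0 \<le> t" and f: "f \<in> vanishing X"
  shows "uniformly_Cauchy_on X (\<lambda>n. E n t f)"
  unfolding uniformly_Cauchy_on_def
proof (intro allI impI)
  fix e :: real assume e: "0 < e"
  obtain F where F: "finite F" "\<And>x. x \<in> X \<Longrightarrow> \<bar>f x - f x * indicat_real F x\<bar> \<le> e / 6"
    \<comment> \<open>Three errors of \<open>e / 6\<close> occur in comparing index \<open>m\<close>
      with \<open>n\<close>, and two such comparisons bound the distance between \<open>m\<close>
      and \<open>k\<close>.\<close>
    using vanishing_approx[OF f, of "e/6"] e by (metis divide_pos_pos order_refl zero_less_numeral)
  let ?g = "\<lambda>x. f x * indicat_real F x"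
  obtain c where c: "0 \<le> c" "rapid c ?g" using finite_support_rapid[OF F(1)] .
  let ?D = "2 * (c * B + t * c * exp (C * t) * B')"
  have D: "0 \<le> ?D" using c B_pos t B'_nonneg by simp
  have "(\<lambda>n. ?D * (1/2)^n) \<longlonglongrightarrow> ?D * 0" by (intro tendsto_intros half_power_tendsto)
  then have "eventually (\<lambda>n. ?D * (1/2)^n < e / 6) sequentially"
    using e by (intro order_tendstoD) auto
  then obtain n where n: "?D * (1/2)^n < e / 6" by (auto dest: eventually_happens)
  have close: "\<bar>E m t f x - E n t f x\<bar> < e / 2" if "n \<le> m" "x \<in> X" for m x
  proof -
    have "?D * ((1/2)^n - (1/2)^m) \<le> ?D * (1/2)^n" using D by (intro mult_left_mono) auto
    then have "\<bar>E m t ?g x - E n t ?g x\<bar> < e / 6"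
      using E_Cauchy_rapid[OF t c(2,1) that(2,1)] n by linarith
    then show ?thesis
      using E_approx[of f ?g, OF F(2) that(2), of m t] E_approx[of f ?g, OF F(2) that(2), of n t]
      by linarith
  qed
  show "\<exists>n. \<forall>x\<in>X. \<forall>m\<ge>n. \<forall>k\<ge>n. dist (E m t f x) (E k t f x) < e"
  proof (intro exI ballI allI impI)
    fix x m k assume "x \<in> X" "n \<le> m" "n \<le> k"
    then show "dist (E m t f x) (E k t f x) < e"
      using close[of m x] close[of k x] unfolding dist_real_def by linarith
  qed
qed

lemma E_uniform_limit:
  assumes "0 \<le> t" "f \<in> vanishing X"
  shows "uniform_limit X (\<lambda>n. E n t f) (P t f) sequentially"
  using Cauchy_uniformly_convergent[OF E_uniformly_Cauchy[OF assms]]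
  unfolding uniformly_convergent_uniform_limit_iff P_def[abs_def] .

lemma E_tendsto:
  assumes "0 \<le> t" "f \<in> vanishing X" "x \<in> X"
  shows "(\<lambda>n. E n t f x) \<longlonglongrightarrow> P t f x"
  using E_uniform_limit[OF assms(1,2)] assms(3) by (rule tendsto_uniform_limitI)

lemma P_lin:
  assumes t: "0 \<le> t" and f: "f \<in> vanishing X" and g: "g \<in> vanishing X" and x: "x \<in> X"
  shows "P t (\<lambda>x. a * f x + b * g x) x = a * P t f x + b * P t g x"
proof (rule LIMSEQ_unique)
  show "(\<lambda>n. E n t (\<lambda>x. a * f x + b * g x) x) \<longlonglongrightarrow> P t (\<lambda>x. a * f x + b * g x) x"
    by (intro E_tendsto vanishing_add vanishing_scale t f g x)
  show "(\<lambda>n. E n t (\<lambda>x. a * f x + b * g x) x) \<longlonglongrightarrow> a * P t f x + b * P t g x"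
    unfolding E_lin by (intro tendsto_intros E_tendsto t f g x)
qed

lemma P_diff:
  assumes "0 \<le> t" "f \<in> vanishing X" "g \<in> vanishing X" "x \<in> X"
  shows "P t (\<lambda>x. f x - g x) x = P t f x - P t g x"
  using P_lin[OF assms, of 1 "-1"] by simp

lemma P_contraction:
  assumes "0 \<le> t" "f \<in> vanishing X" "\<And>x. x \<in> X \<Longrightarrow> \<bar>f x\<bar> \<le> c" "x \<in> X"
  shows "\<bar>P t f x\<bar> \<le> c"
  by (rule LIMSEQ_le_const2[OF tendsto_rabs[OF E_tendsto[OF assms(1,2,4)]]])
    (use E_contraction[OF assms(3,4)] in auto)

lemma P_approx:
  assumes "0 \<le> t" "f \<in> vanishing X" "g \<in> vanishing X" "\<And>x. x \<in> X \<Longrightarrow> \<bar>f x - g x\<bar> \<le> e" "x \<in> X"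
  shows "\<bar>P t f x - P t g x\<bar> \<le> e"
  using P_contraction[OF assms(1) vanishing_diff[OF assms(2,3)] assms(4,5)]
  by (simp add: P_diff[OF assms(1-3,5)])

lemma P_mono:
  assumes t: "0 \<le> t" and f: "f \<in> vanishing X" and g: "g \<in> vanishing X"
    and le: "\<And>x. x \<in> X \<Longrightarrow> f x \<le> g x" and x: "x \<in> X"
  shows "P t f x \<le> P t g x"
  by (rule LIMSEQ_le[OF E_tendsto[OF t f x] E_tendsto[OF t g x]])
    (auto simp: E_def intro!: Kpow_mono le x)

lemma P_0: "P 0 f = f"
  by (simp add: P_def E_def fun_eq_iff)

text \<open>For truncations of \<open>f\<close> the bound of \<open>E_rapid\<close> is uniform in
  \<open>n\<close> and survives the limit; uniform closedness covers general
  \<open>f\<close>.\<close>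

lemma P_vanishing:
  assumes t: "0 \<le> t" and f: "f \<in> vanishing X"
  shows "P t f \<in> vanishing X"
proof (rule vanishing_closed)
  fix e :: real assume "0 < e"
  then obtain F where F: "finite F" "\<And>x. x \<in> X \<Longrightarrow> \<bar>f x - f x * indicat_real F x\<bar> \<le> e"
    using vanishing_approx[OF f, of e] by (metis order_refl)
  let ?g = "\<lambda>x. f x * indicat_real F x"
  have g: "?g \<in> vanishing X" by (rule vanishing_finite_support[OF F(1)])
  obtain c where c: "0 \<le> c" "rapid c ?g" using finite_support_rapid[OF F(1)] .
  have "rapid (c * exp (C * t)) (P t ?g)"
    unfolding rapid_def
  proof
    fix x assume x: "x \<in> X"
    show "\<bar>P t ?g x\<bar> \<le> c * exp (C * t) / (\<Phi> x)\<^sup>2"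
      by (rule LIMSEQ_le_const2[OF tendsto_rabs[OF E_tendsto[OF t g x]]])
        (use E_rapid[OF t c(2,1) x] in auto)
  qed
  then have "P t ?g \<in> vanishing X"
    using c(1) by (intro order_1_vanishing[where c="c * exp (C * t)"] rapid_order_1) auto
  moreover have "\<forall>x\<in>X. \<bar>P t f x - P t ?g x\<bar> \<le> e"
    using P_approx[OF t f g F(2)] by blast
  ultimately show "\<exists>g\<in>vanishing X. \<forall>x\<in>X. \<bar>P t f x - g x\<bar> \<le> e" by blast
qed

text \<open>Makes a single surplus step negligible in \<open>P_semigroup\<close>.\<close>

lemma K_tendsto_identity:
  assumes f: "f \<in> vanishing X" and e: "0 < e"
  shows "eventually (\<lambda>n. \<forall>x\<in>X. \<bar>K ((1/2)^n) f x - f x\<bar> \<le> e) sequentially"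
proof -
  obtain F where F: "finite F" "\<And>x. x \<in> X \<Longrightarrow> \<bar>f x - f x * indicat_real F x\<bar> \<le> e / 3"
    using vanishing_approx[OF f, of "e/3"] e by (metis divide_pos_pos order_refl zero_less_numeral)
  let ?g = "\<lambda>x. f x * indicat_real F x"
  obtain c where c: "0 \<le> c" "rapid c ?g" using finite_support_rapid[OF F(1)] .
  have "(\<lambda>n. (1/2)^n * (c * B)) \<longlonglongrightarrow> 0 * (c * B)" by (intro tendsto_intros half_power_tendsto)
  then have "eventually (\<lambda>n. (1/2)^n * (c * B) < e / 3) sequentially"
    using e by (intro order_tendstoD) auto
  then show ?thesis
  proof (rule eventually_mono, intro ballI)
    fix n x assume n: "(1/2)^n * (c * B) < e / 3" and x: "x \<in> X"
    have "\<bar>(K ((1/2)^n) ^^ 1) ?g x - ?g x\<bar> \<le> real 1 * (1/2)^n * (c * B)"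
      by (rule Kpow_small[OF _ A_order_0[OF c(2,1)] x]) auto
    moreover have "\<bar>(K ((1/2)^n) ^^ 1) (\<lambda>x. f x - ?g x) x\<bar> \<le> e / 3"
      by (rule Kpow_contraction[OF _ F(2) x]) auto
    ultimately show "\<bar>K ((1/2)^n) f x - f x\<bar> \<le> e"
      using n F(2)[OF x] unfolding Kpow_diff by (simp add: abs_if split: if_splits)
  qed
qed

lemma P_semigroup:
  assumes s: "0 \<le> s" and t: "0 \<le> t" and f: "f \<in> vanishing X" and x: "x \<in> X"
  shows "P (s + t) f x = P s (P t f) x"
proof (rule LIMSEQ_unique)
  show "(\<lambda>n. E n (s + t) f x) \<longlonglongrightarrow> P (s + t) f x" using s t by (intro E_tendsto f x) auto
  have "(\<lambda>n. E n (s + t) f x - E n s (P t f) x) \<longlonglongrightarrow> 0"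
  proof (rule LIMSEQ_I)
    fix e :: real assume e: "0 < e"
    have ev1: "eventually (\<lambda>n. \<forall>x\<in>X. \<bar>K ((1/2)^n) f x - f x\<bar> \<le> e / 3) sequentially"
      using e by (intro K_tendsto_identity f) auto
    have ev2: "eventually (\<lambda>n. \<forall>x\<in>X. dist (E n t f x) (P t f x) < e / 3) sequentially"
      using uniform_limitD[OF E_uniform_limit[OF t f], of "e/3"] e by auto
    have "eventually (\<lambda>n. norm (E n (s + t) f x - E n s (P t f) x - 0) < e) sequentially"
      using ev1 ev2
    proof eventually_elim
      case (elim n)
      let ?h = "(1/2::real)^n"
      let ?i = "nat \<lfloor>s * 2^n\<rfloor>" and ?j = "nat \<lfloor>t * 2^n\<rfloor>"
      have h: "0 \<le> ?h" by simp
      \<comment> \<open>The step counts for \<open>s\<close> and \<open>t\<close> add up to that for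
        \<open>s + t\<close>, or fall short by one; otherwise the powers of \<open>K ?h\<close>
        compose exactly.\<close>
      have fl: "\<lfloor>s * 2^n + t * 2^n\<rfloor> = \<lfloor>s * 2^n\<rfloor> + \<lfloor>t * 2^n\<rfloor> \<or>
          \<lfloor>s * 2^n + t * 2^n\<rfloor> = \<lfloor>s * 2^n\<rfloor> + \<lfloor>t * 2^n\<rfloor> + 1"
        by linarith
      have nn: "0 \<le> \<lfloor>s * 2^n\<rfloor>" "0 \<le> \<lfloor>t * 2^n\<rfloor>" using s t by simp_all
      have "nat \<lfloor>(s + t) * 2^n\<rfloor> = ?i + ?j \<or> nat \<lfloor>(s + t) * 2^n\<rfloor> = ?i + ?j + 1"
        using fl nn unfolding distrib_right by (auto simp: nat_add_distrib)
      then have 1: "\<bar>E n (s + t) f x - E n s (E n t f) x\<bar> \<le> e / 3"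
      proof
        assume "nat \<lfloor>(s + t) * 2^n\<rfloor> = ?i + ?j"
        then show ?thesis using e by (simp add: E_def funpow_add)
      next
        assume eq: "nat \<lfloor>(s + t) * 2^n\<rfloor> = ?i + ?j + 1"
        have "\<bar>(K ?h ^^ (?i + ?j)) (\<lambda>x. K ?h f x - f x) x\<bar> \<le> e / 3"
          by (rule Kpow_contraction[OF h _ x]) (use elim(1) in auto)
        moreover have "E n (s + t) f = (K ?h ^^ (?i + ?j)) (K ?h f)"
          unfolding E_def eq Suc_eq_plus1[symmetric] funpow_Suc_right by simp
        moreover have "E n s (E n t f) = (K ?h ^^ (?i + ?j)) f" by (simp add: E_def funpow_add)
        ultimately show ?thesis unfolding Kpow_diff by simp
      qed
      have "\<bar>E n s (E n t f) x - E n s (P t f) x\<bar> \<le> e / 3"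
        by (rule E_approx[OF _ x]) (use elim(2) in \<open>auto simp: dist_real_def less_imp_le\<close>)
      with 1 e show ?case unfolding diff_0_right real_norm_def by linarith
    qed
    then show "\<exists>n0. \<forall>n\<ge>n0. norm (E n (s + t) f x - E n s (P t f) x - 0) < e"
      by (simp add: eventually_sequentially)
  qed
  from tendsto_add[OF this E_tendsto[OF s P_vanishing[OF t f] x]]
  show "(\<lambda>n. E n (s + t) f x) \<longlonglongrightarrow> P s (P t f) x" by simp
qed

section \<open>Small times and the generator\<close>

lemma P_taylor:
  assumes t: "0 \<le> t" and f: "rapid c f" and c: "0 \<le> c"
    and fg: "\<And>x. x \<in> X \<Longrightarrow> \<bar>A f x - g x\<bar> \<le> \<delta>"
    and g: "\<And>x. x \<in> X \<Longrightarrow> \<bar>A g x\<bar> \<le> d" and x: "x \<in> X"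
  shows "\<bar>P t f x - f x - t * A f x\<bar> \<le> t * (2 * \<delta> + t * d)"
proof (rule LIMSEQ_le)
  let ?s = "\<lambda>n. real (nat \<lfloor>t * 2^n\<rfloor>) * (1/2)^n"
  have fv: "f \<in> vanishing X" using rapid_order_1[OF f c] by (rule order_1_vanishing)
  show "(\<lambda>n. \<bar>E n t f x - f x - ?s n * A f x\<bar>) \<longlonglongrightarrow> \<bar>P t f x - f x - t * A f x\<bar>"
    by (intro tendsto_intros E_tendsto steps_tendsto t fv x)
  \<comment> \<open>The only term containing \<open>c\<close> disappears in the limit, so the final
    bound does not see how slowly \<open>f\<close> enters the rapid regime.\<close>
  have "(\<lambda>n. ?s n * (2 * \<delta> + ?s n * d + c * B * M * (1/2)^n))
      \<longlonglongrightarrow> t * (2 * \<delta> + t * d + c * B * M * 0)"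
    by (intro tendsto_intros steps_tendsto half_power_tendsto t)
  then show "(\<lambda>n. ?s n * (2 * \<delta> + ?s n * d + c * B * M * (1/2)^n)) \<longlonglongrightarrow> t * (2 * \<delta> + t * d)" by simp
  show "\<exists>n0. \<forall>n\<ge>n0. \<bar>E n t f x - f x - ?s n * A f x\<bar>
      \<le> ?s n * (2 * \<delta> + ?s n * d + c * B * M * (1/2)^n)"
    unfolding E_def by (intro exI allI impI Kpow_taylor[where g=g, OF _ f c fg g x]) auto
qed

lemma P_taylor_rapid:
  assumes t: "0 \<le> t" and f: "rapid c f" and c: "0 \<le> c" and x: "x \<in> X"
  shows "\<bar>P t f x - f x - t * A f x\<bar> \<le> t\<^sup>2 * (c * B * B)"
proof -
  have "\<bar>P t f x - f x - t * A f x\<bar> \<le> t * (2 * 0 + t * (c * B * B))"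
    using c B_pos by (intro P_taylor[OF t f c _ _ x, where g="A f"] A_order_1[OF A_rapid[OF f c]]) auto
  then show ?thesis by (simp add: power2_eq_square)
qed

lemma P_strongly_continuous:
  assumes f: "f \<in> vanishing X" and e: "0 < e"
  shows "eventually (\<lambda>t. \<forall>x\<in>X. \<bar>P t f x - f x\<bar> \<le> e) (at_right 0)"
proof -
  obtain F where F: "finite F" "\<And>x. x \<in> X \<Longrightarrow> \<bar>f x - f x * indicat_real F x\<bar> \<le> e / 3"
    using vanishing_approx[OF f, of "e/3"] e by (metis divide_pos_pos order_refl zero_less_numeral)
  let ?g = "\<lambda>x. f x * indicat_real F x"
  have g: "?g \<in> vanishing X" by (rule vanishing_finite_support[OF F(1)])
  obtain c where c: "0 \<le> c" "rapid c ?g" using finite_support_rapid[OF F(1)] .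
  have "((\<lambda>t. t\<^sup>2 * (c * B * B) + t * (c * B)) \<longlongrightarrow> 0\<^sup>2 * (c * B * B) + 0 * (c * B)) (at_right (0::real))"
    by (intro tendsto_intros)
  then have "eventually (\<lambda>t. t\<^sup>2 * (c * B * B) + t * (c * B) < e / 3) (at_right (0::real))"
    using e by (intro order_tendstoD) auto
  moreover have "eventually (\<lambda>t::real. 0 < t) (at_right 0)" by (rule eventually_at_right_less)
  ultimately show ?thesis
  proof eventually_elim
    case (elim t)
    show ?case
    proof
      fix x assume x: "x \<in> X"
      have t: "0 \<le> t" using elim by simp
      have "\<bar>t * A ?g x\<bar> \<le> t * (c * B)"
        using A_order_0[OF c(2,1) x] t by (simp add: abs_mult mult_left_mono)
      then show "\<bar>P t f x - f x\<bar> \<le> e"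
        using P_taylor_rapid[OF t c(2,1) x] P_approx[OF t f g F(2) x] F(2)[OF x] elim(1) by linarith
    qed
  qed
qed

lemma generator_if:
  assumes f: "f \<in> vanishing X" and Af: "A f \<in> vanishing X" and e: "0 < e"
  shows "eventually (\<lambda>t. \<forall>x\<in>X. \<bar>(P t f x - f x) / t - A f x\<bar> \<le> e) (at_right 0)"
proof -
  \<comment> \<open>The truncation \<open>?g\<close> and its constant \<open>d\<close> depend on
    \<open>e\<close> alone, not on \<open>t\<close> or on the approximations of \<open>f\<close>
    chosen later.\<close>
  obtain F where F: "finite F" "\<And>x. x \<in> X \<Longrightarrow> \<bar>A f x - A f x * indicat_real F x\<bar> \<le> e / 8"
    using vanishing_approx[OF Af, of "e/8"] e by (metis divide_pos_pos order_refl zero_less_numeral)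
  let ?g = "\<lambda>x. A f x * indicat_real F x"
  obtain d where d: "0 \<le> d" "rapid d ?g" using finite_support_rapid[OF F(1)] .
  \<comment> \<open>At fixed \<open>t\<close> and \<open>x\<close>, \<open>f\<close> is approximated
    by rapid functions \<open>u\<close> whose constants may blow up; the bound of
    \<open>P_taylor\<close> is free of them, so \<epsilon> can tend to zero.\<close>
  have main: "\<bar>P t f x - f x - t * A f x\<bar> \<le> t * (e / 2 + t * (d * B))"
    if t: "0 < t" and x: "x \<in> X" for t x
  proof (rule field_le_epsilon)
    fix \<epsilon> :: real assume eps: "0 < \<epsilon>"
    \<comment> \<open>The first entry keeps \<open>A u\<close> within \<open>e / 4\<close> of
      \<open>?g\<close>; the second makes the errors \<eta>, \<eta> and \<open>t * \<eta>\<close>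
      from \<open>P t f\<close>, \<open>f\<close> and \<open>t * A f\<close> sum to at most
      \<epsilon>.\<close>
    define \<eta> where "\<eta> = min (e / 8) (\<epsilon> / (2 + t))"
    have eta: "0 < \<eta>" "\<eta> \<le> e / 8" "\<eta> * (2 + t) \<le> \<epsilon>"
    proof -
      show "0 < \<eta>" using eps e t by (simp add: \<eta>_def)
      show "\<eta> \<le> e / 8" unfolding \<eta>_def by (rule min.cobounded1)
      have "\<eta> * (2 + t) \<le> \<epsilon> / (2 + t) * (2 + t)"
        using t by (intro mult_right_mono) (auto simp: \<eta>_def)
      then show "\<eta> * (2 + t) \<le> \<epsilon>" using t by simp
    qed
    obtain c u where u: "0 \<le> c" "rapid c u" "\<And>x. x \<in> X \<Longrightarrow> \<bar>f x - u x\<bar> \<le> \<eta>"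
      "\<And>x. x \<in> X \<Longrightarrow> \<bar>A f x - A u x\<bar> \<le> \<eta>"
      using rapid_core[OF f Af eta(1)] by blast
    have uv: "u \<in> vanishing X" using rapid_order_1[OF u(2,1)] by (rule order_1_vanishing)
    have "\<bar>A u y - ?g y\<bar> \<le> e / 4" if "y \<in> X" for y
      using u(4)[OF that] F(2)[OF that] eta(2) by linarith
    then have 1: "\<bar>P t u x - u x - t * A u x\<bar> \<le> t * (2 * (e / 4) + t * (d * B))"
      using t by (intro P_taylor[OF _ u(2,1) _ A_order_0[OF d(2,1)] x]) auto
    have 2: "\<bar>P t f x - P t u x\<bar> \<le> \<eta>"
      using t by (intro P_approx f uv u(3) x) auto
    have "t * \<bar>A f x - A u x\<bar> \<le> t * \<eta>" using u(4)[OF x] t by (intro mult_left_mono) auto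
    then have 3: "\<bar>t * A f x - t * A u x\<bar> \<le> t * \<eta>"
      using t by (simp add: abs_mult flip: right_diff_distrib)
    show "\<bar>P t f x - f x - t * A f x\<bar> \<le> t * (e / 2 + t * (d * B)) + \<epsilon>"
      using 1 2 3 u(3)[OF x] eta(3) by (simp add: algebra_simps)
  qed
  have "((\<lambda>t. e / 2 + t * (d * B)) \<longlongrightarrow> e / 2 + 0 * (d * B)) (at_right (0::real))"
    by (intro tendsto_intros)
  from order_tendstoD(2)[OF this, of e]
  have "eventually (\<lambda>t. e / 2 + t * (d * B) < e) (at_right (0::real))" using e by simp
  moreover have "eventually (\<lambda>t::real. 0 < t) (at_right 0)" by (rule eventually_at_right_less)
  ultimately show ?thesis
  proof eventually_elim
    case (elim t)
    show ?case
    proof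
      fix x assume x: "x \<in> X"
      have "(P t f x - f x) / t - A f x = (P t f x - f x - t * A f x) / t"
        using elim(2) by (simp add: field_simps)
      then have "\<bar>(P t f x - f x) / t - A f x\<bar> = \<bar>P t f x - f x - t * A f x\<bar> / t"
        using elim(2) by simp
      also have "\<dots> \<le> t * (e / 2 + t * (d * B)) / t"
        using main[OF elim(2) x] elim(2) by (intro divide_right_mono) auto
      also have "\<dots> \<le> e" using elim by simp
      finally show "\<bar>(P t f x - f x) / t - A f x\<bar> \<le> e" .
    qed
  qed
qed

text \<open>Mass leaving the finite set of neighbours of \<open>x\<close> is \<open>O(t\<^sup>2)\<close>, because the
  semigroup is conservative and \<open>A\<close> annihilates at \<open>x\<close> the indicator of that set.\<close>
lemma P_pointwise_derivative:
  assumes f: "f \<in> vanishing X" and x: "x \<in> X"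
  shows "((\<lambda>t. (P t f x - f x) / t) \<longlongrightarrow> A f x) (at_right 0)"
proof -
  define F where "F = insert x ((\<lambda>i. \<sigma> i x) ` I)"
  have F: "finite F" using finite_I by (simp add: F_def)
  have A_F: "A (\<lambda>y. u y * indicat_real F y) x = A u x" for u
    unfolding A_def by (intro sum.cong) (auto simp: F_def)
  let ?f = "\<lambda>y. f y * indicat_real F y" and ?one = "\<lambda>y. 1 * indicat_real F y"
  obtain b where b: "0 \<le> b" "\<And>x. x \<in> X \<Longrightarrow> \<bar>f x\<bar> \<le> b" using vanishing_bounded[OF f] by blast
  obtain c where c: "0 \<le> c" "rapid c ?f" using finite_support_rapid[OF F] .
  obtain d where d: "0 \<le> d" "rapid d ?one" using finite_support_rapid[OF F] .
  have fv: "?f \<in> vanishing X" and v1: "?one \<in> vanishing X"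
    by (rule vanishing_finite_support[OF F])+
  let ?D = "c * B * B + b * (d * B * B)"
  have bound: "\<bar>P t f x - f x - t * A f x\<bar> \<le> t\<^sup>2 * ?D" if t: "0 \<le> t" for t
  proof -
    have 1: "\<bar>P t ?f x - f x - t * A f x\<bar> \<le> t\<^sup>2 * (c * B * B)"
      using P_taylor_rapid[OF t c(2,1) x] unfolding A_F by (simp add: F_def)
    have "A (\<lambda>y. 1) x = 0" by (simp add: A_def)
    then have 2: "\<bar>P t ?one x - 1\<bar> \<le> t\<^sup>2 * (d * B * B)"
      using P_taylor_rapid[OF t d(2,1) x] unfolding A_F by (simp add: F_def)
    \<comment> \<open>Off \<open>F\<close> the function \<open>f\<close> is at most
      \<open>b\<close>, so the remainder is dominated by \<open>b\<close> times the indicator of the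
      complement. That indicator need not vanish at infinity, so the domination is proved for
      \<open>E\<close> and passed to the limit.\<close>
    have "\<bar>P t (\<lambda>y. f y - ?f y) x\<bar> \<le> b * 1 - b * P t ?one x"
    proof (rule LIMSEQ_le)
      show "(\<lambda>n. \<bar>E n t (\<lambda>y. f y - ?f y) x\<bar>) \<longlonglongrightarrow> \<bar>P t (\<lambda>y. f y - ?f y) x\<bar>"
        by (intro tendsto_intros E_tendsto vanishing_diff f fv t x)
      show "(\<lambda>n. b * 1 - b * E n t ?one x) \<longlonglongrightarrow> b * 1 - b * P t ?one x"
        by (intro tendsto_intros E_tendsto v1 t x)
      have "\<bar>E n t (\<lambda>y. f y - ?f y) x\<bar> \<le> b * 1 - b * E n t ?one x" for n
      proof -
        have "\<bar>E n t (\<lambda>y. f y - ?f y) x\<bar> \<le> E n t (\<lambda>y. b * 1 + (- b) * ?one y) x"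
          unfolding E_def by (rule Kpow_abs[OF _ _ x]) (auto simp: indicator_def b(2))
        also have "\<dots> = b * 1 - b * E n t ?one x" unfolding E_lin by (simp add: E_def Kpow_const)
        finally show ?thesis .
      qed
      then show "\<exists>n0. \<forall>n\<ge>n0. \<bar>E n t (\<lambda>y. f y - ?f y) x\<bar> \<le> b * 1 - b * E n t ?one x" by blast
    qed
    also have "\<dots> = b * (1 - P t ?one x)" by (simp add: algebra_simps)
    also have "\<dots> \<le> b * (t\<^sup>2 * (d * B * B))" using 2 b(1) by (intro mult_left_mono) auto
    finally have "\<bar>P t f x - P t ?f x\<bar> \<le> t\<^sup>2 * (b * (d * B * B))"
      unfolding P_diff[OF t f fv x] by (simp add: mult_ac)
    with 1 show ?thesis by (simp add: distrib_left)
  qed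
  have "((\<lambda>t. (P t f x - f x) / t - A f x) \<longlongrightarrow> 0) (at_right 0)"
  proof (rule Lim_null_comparison)
    show "eventually (\<lambda>t. norm ((P t f x - f x) / t - A f x) \<le> t * ?D) (at_right 0)"
      using eventually_at_right_less[of "0::real"]
    proof eventually_elim
      case (elim t)
      have "(P t f x - f x) / t - A f x = (P t f x - f x - t * A f x) / t"
        using elim by (simp add: field_simps)
      then have "\<bar>(P t f x - f x) / t - A f x\<bar> = \<bar>P t f x - f x - t * A f x\<bar> / t"
        using elim by simp
      also have "\<dots> \<le> t\<^sup>2 * ?D / t"
        using bound[of t] elim by (intro divide_right_mono) auto
      also have "\<dots> = t * ?D" using elim by (simp add: power2_eq_square)
      finally show ?case by simp
    qed
    have "((\<lambda>t. t * ?D) \<longlongrightarrow> 0 * ?D) (at_right (0::real))" by (intro tendsto_intros)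
    then show "((\<lambda>t. t * ?D) \<longlongrightarrow> 0) (at_right (0::real))" by simp
  qed
  then show ?thesis by (simp add: LIM_zero_iff)
qed

section \<open>The transition kernel\<close>

definition p :: "real \<Rightarrow> 'a \<Rightarrow> 'a \<Rightarrow> real" where
  "p t x y = P t (indicat_real {y}) x"

lemma indicator_vanishing: "finite F \<Longrightarrow> indicat_real F \<in> vanishing X"
  using vanishing_finite_support[of F "\<lambda>_. 1"] by simp

lemma p_nonneg:
  assumes "0 \<le> t" "x \<in> X"
  shows "0 \<le> p t x y"
proof -
  have "P t (\<lambda>_. 0) x \<le> p t x y"
    unfolding p_def using assms by (intro P_mono indicator_vanishing) (auto simp: vanishing_def)
  moreover have "P t (\<lambda>_. 0) x = 0" by (simp add: P_def E_def Kpow_const)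
  ultimately show ?thesis by simp
qed

lemma P_finite_support:
  assumes "finite F" "0 \<le> t" "x \<in> X"
  shows "P t (\<lambda>y. f y * indicat_real F y) x = (\<Sum>y\<in>F. p t x y * f y)"
  using assms(1)
proof (induction F rule: finite_induct)
  case empty
  show ?case by (simp add: P_def E_def Kpow_const)
next
  case (insert a F)
  have "(\<lambda>y. f y * indicat_real (insert a F) y)
      = (\<lambda>y. f a * indicat_real {a} y + 1 * (f y * indicat_real F y))"
    using insert.hyps by (auto simp: indicator_def)
  then have "P t (\<lambda>y. f y * indicat_real (insert a F) y) x
      = f a * P t (indicat_real {a}) x + 1 * P t (\<lambda>y. f y * indicat_real F y) x"
    using assms insert.hyps
    by (simp only: P_lin[OF assms(2) indicator_vanishing vanishing_finite_support assms(3)]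
        finite.emptyI finite.insertI)
  then show ?case using insert by (simp add: p_def mult.commute)
qed

lemma P_has_sum:
  assumes t: "0 \<le> t" and x: "x \<in> X" and f: "f \<in> vanishing X"
  shows "((\<lambda>y. p t x y * f y) has_sum P t f x) X"
  unfolding has_sum_def tendsto_iff eventually_finite_subsets_at_top
proof (intro allI impI)
  fix e :: real assume e: "0 < e"
  obtain F where F: "finite F" "F \<subseteq> X"
    "\<And>G x. F \<subseteq> G \<Longrightarrow> x \<in> X \<Longrightarrow> \<bar>f x - f x * indicat_real G x\<bar> \<le> e / 2"
    using vanishing_approx[OF f, of "e/2"] e by auto
  show "\<exists>F. finite F \<and> F \<subseteq> X \<and>
      (\<forall>G. finite G \<and> F \<subseteq> G \<and> G \<subseteq> X \<longrightarrow> dist (\<Sum>y\<in>G. p t x y * f y) (P t f x) < e)"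
  proof (rule exI[of _ F], intro conjI allI impI F(1,2))
    fix G assume G: "finite G \<and> F \<subseteq> G \<and> G \<subseteq> X"
    then have "\<bar>P t f x - P t (\<lambda>y. f y * indicat_real G y) x\<bar> \<le> e / 2"
      by (intro P_approx t f vanishing_finite_support F(3) x) auto
    then show "dist (\<Sum>y\<in>G. p t x y * f y) (P t f x) < e"
      using P_finite_support[of G t x f] G t x e by (simp add: dist_real_def abs_minus_commute)
  qed
qed

text \<open>No mass escapes to infinity: the expectation of \<open>\<Phi>\<close> grows at most exponentially.\<close>
lemma p_conservative:
  assumes t: "0 \<le> t" and x: "x \<in> X"
  shows "(p t x has_sum 1) X"
  unfolding has_sum_def tendsto_iff eventually_finite_subsets_at_top
proof (intro allI impI)
  fix e :: real assume e: "0 < e"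
  \<comment> \<open>Markov's inequality: the mass where \<Phi> exceeds \<open>R\<close> is at most
    \<open>exp (C * t) * \<Phi> x / R\<close>, which this \<open>R\<close> turns into
    \<open>e / 2\<close>.\<close>
  define R where "R = 2 * (exp (C * t) * \<Phi> x) / e"
  have px: "0 < exp (C * t) * \<Phi> x" using Phi_pos[OF x] by simp
  then have R: "0 < R" using e by (simp add: R_def)
  show "\<exists>F. finite F \<and> F \<subseteq> X \<and> (\<forall>G. finite G \<and> F \<subseteq> G \<and> G \<subseteq> X \<longrightarrow> dist (\<Sum>y\<in>G. p t x y) 1 < e)"
  proof (intro exI conjI allI impI)
    show "finite {x \<in> X. \<Phi> x \<le> R}" by (rule finite_sublevel)
    fix G assume G: "finite G \<and> {x \<in> X. \<Phi> x \<le> R} \<subseteq> G \<and> G \<subseteq> X"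
    then have Gv: "indicat_real G \<in> vanishing X" by (intro indicator_vanishing) auto
    have sum: "(\<Sum>y\<in>G. p t x y) = P t (indicat_real G) x"
      using P_finite_support[of G t x "\<lambda>_. 1"] G t x by simp
    have up: "P t (indicat_real G) x \<le> 1"
      using P_contraction[OF t Gv, of 1 x] x by (auto simp: indicator_def abs_le_iff)
    have "1 - exp (C * t) * \<Phi> x / R \<le> P t (indicat_real G) x"
    proof (rule LIMSEQ_le_const[OF E_tendsto[OF t Gv x]], intro exI allI impI)
      fix n :: nat
      let ?h = "(1/2::real)^n" and ?j = "nat \<lfloor>t * 2^n\<rfloor>"
      have "(K ?h ^^ ?j) \<Phi> x \<le> (1 + C * ?h)^?j * \<Phi> x"
        by (intro Kpow_superharmonic A_Phi x) (auto simp: Phi_pos less_imp_le)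
      also have "\<dots> \<le> exp (C * t) * \<Phi> x"
        using growth_le[OF t] Phi_pos[OF x] by (intro mult_right_mono) auto
      finally have "E n t \<Phi> x / R \<le> exp (C * t) * \<Phi> x / R"
        unfolding E_def using R by (intro divide_right_mono) auto
      moreover have "E n t (\<lambda>y. 1 * 1 + (- 1 / R) * \<Phi> y) x \<le> E n t (indicat_real G) x"
        unfolding E_def
      proof (rule Kpow_mono[OF _ _ x])
        fix y assume y: "y \<in> X"
        show "1 * 1 + (- 1 / R) * \<Phi> y \<le> indicat_real G y"
        proof (cases "y \<in> G")
          case True
          then show ?thesis using R Phi_pos[OF y] by simp
        next
          case False
          then have "R < \<Phi> y" using G y by auto
          then show ?thesis using R False by simp
        qed
      qed simp
      moreover have "E n t (\<lambda>y. 1 * 1 + (- 1 / R) * \<Phi> y) x = 1 - E n t \<Phi> x / R"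
        unfolding E_lin by (simp add: E_def Kpow_const)
      ultimately show "1 - exp (C * t) * \<Phi> x / R \<le> E n t (indicat_real G) x" by linarith
    qed
    moreover have "exp (C * t) * \<Phi> x / R = e / 2"
      using px e unfolding R_def by (simp add: field_simps) (use Phi_pos[OF x] in simp)
    ultimately show "dist (\<Sum>y\<in>G. p t x y) 1 < e"
      using up e unfolding sum dist_real_def by linarith
  qed auto
qed

end

section \<open>Weighted power sums over finite sets of integers\<close>

text \<open>For \<open>T\<close> the set of entries of a tuple and \<open>s\<close> equal to 1 or -1
  this is the Vandermonde ratio (\<open>Vdm_ratio\<close>). Indexing by values instead of positions
  permits induction by inserting one entry.\<close>

definition shift_weight :: "real \<Rightarrow> int set \<Rightarrow> int \<Rightarrow> real" where
  "shift_weight s T k = (\<Prod>j\<in>T - {k}. 1 + s / real_of_int (k - j))"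

lemma shift_weight_insert:
  assumes "finite T" "a \<notin> T" "k \<in> T"
  shows "shift_weight s (insert a T) k = (1 + s / real_of_int (k - a)) * shift_weight s T k"
proof -
  have "insert a T - {k} = insert a (T - {k})" using assms by auto
  then show ?thesis using assms by (simp add: shift_weight_def)
qed

lemma shift_weight_new:
  assumes "a \<notin> T"
  shows "shift_weight s (insert a T) a = (\<Prod>j\<in>T. 1 + s / real_of_int (a - j))"
  using assms by (simp add: shift_weight_def)

text \<open>As a rational function of \<open>a\<close>, the product tends to 1 at infinity and has
  simple poles at the points \<open>k\<close> of \<open>T\<close>, with residues
  \<open>s * shift_weight s T k\<close>.\<close>

lemma partial_fractions:
  assumes "finite T" "a \<notin> T"
  shows "(\<Prod>j\<in>T. 1 + s / real_of_int (a - j))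
    = 1 + (\<Sum>k\<in>T. s * shift_weight s T k / real_of_int (a - k))"
  using assms
proof (induction T arbitrary: a rule: finite_induct)
  case (insert b T)
  let ?c = "shift_weight s T"
  have ab: "real_of_int (a - b) \<noteq> 0" using insert.prems by auto
  have "(\<Sum>k\<in>insert b T. s * shift_weight s (insert b T) k / real_of_int (a - k))
    = s * (1 + (\<Sum>k\<in>T. s * ?c k / real_of_int (b - k))) / real_of_int (a - b)
      + (\<Sum>k\<in>T. s * ((1 + s / real_of_int (k - b)) * ?c k) / real_of_int (a - k))"
    \<comment> \<open>The weight of the new point \<open>b\<close> is itself a product over
      \<open>T\<close>, so the induction hypothesis is used at \<open>b\<close> here and at
      \<open>a\<close> in the end.\<close>
    using insert.hyps insert.IH[of b]
    by (simp add: shift_weight_new shift_weight_insert cong: sum.cong)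
  also have "\<dots> = s / real_of_int (a - b) + (\<Sum>k\<in>T. s / real_of_int (a - b) * (s * ?c k / real_of_int (b - k))
      + s * ((1 + s / real_of_int (k - b)) * ?c k) / real_of_int (a - k))"
    by (simp add: distrib_left add_divide_distrib sum_distrib_left sum.distrib sum_divide_distrib mult_ac)
  also have "\<dots> = s / real_of_int (a - b)
      + (\<Sum>k\<in>T. (1 + s / real_of_int (a - b)) * (s * ?c k / real_of_int (a - k)))"
  proof (rule arg_cong2[where f="(+)", OF refl sum.cong[OF refl]])
    fix k assume k: "k \<in> T"
    have alg: "s / x * (s * e / y) + s * ((1 + s / (- y)) * e) / (x + y)
        = (1 + s / x) * (s * e / (x + y))"
      if "x \<noteq> 0" "y \<noteq> 0" "x + y \<noteq> 0" for x y e :: real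
      using that by (simp add: divide_simps) (simp add: algebra_simps)
    have "real_of_int (a - k) = real_of_int (a - b) + real_of_int (b - k)"
      "real_of_int (k - b) = - real_of_int (b - k)" by simp_all
    moreover have "real_of_int (a - b) \<noteq> 0" "real_of_int (b - k) \<noteq> 0"
      "real_of_int (a - b) + real_of_int (b - k) \<noteq> 0"
      using insert.prems insert.hyps k by auto
    ultimately show "s / real_of_int (a - b) * (s * ?c k / real_of_int (b - k))
        + s * ((1 + s / real_of_int (k - b)) * ?c k) / real_of_int (a - k)
      = (1 + s / real_of_int (a - b)) * (s * ?c k / real_of_int (a - k))"
      using alg by (simp only: not_False_eq_True)
  qed
  also have "1 + \<dots> = (1 + s / real_of_int (a - b)) * (1 + (\<Sum>k\<in>T. s * ?c k / real_of_int (a - k)))"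
    by (simp add: sum_distrib_left distrib_left)
  finally show ?case using insert.hyps insert.IH[of a] insert.prems by simp
qed simp

text \<open>Expanding the weight of \<open>a\<close> in partial fractions combines the terms into
  divided differences of \<open>g\<close>. These lower the degree by one: for cubes the correction
  is quadratic.\<close>

lemma weighted_sum_insert:
  assumes T: "finite T" "a \<notin> T"
  shows "(\<Sum>k\<in>insert a T. g k * shift_weight s (insert a T) k)
    = (\<Sum>k\<in>T. g k * shift_weight s T k) + g a
      + s * (\<Sum>k\<in>T. (g k - g a) / real_of_int (k - a) * shift_weight s T k)"
proof -
  let ?c = "shift_weight s T"
  have "(\<Sum>k\<in>insert a T. g k * shift_weight s (insert a T) k)
    = g a * (1 + (\<Sum>k\<in>T. s * ?c k / real_of_int (a - k)))
      + (\<Sum>k\<in>T. g k * ((1 + s / real_of_int (k - a)) * ?c k))"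
    using T by (simp add: shift_weight_new partial_fractions shift_weight_insert cong: sum.cong del: of_int_diff)
  also have "\<dots> = g a + (\<Sum>k\<in>T. g a * (s * ?c k / real_of_int (a - k))
      + g k * ((1 + s / real_of_int (k - a)) * ?c k))"
    by (simp add: distrib_left sum_distrib_left sum.distrib)
  also have "\<dots> = g a + (\<Sum>k\<in>T. g k * ?c k + s * ((g k - g a) / real_of_int (k - a) * ?c k))"
  proof (rule arg_cong2[where f="(+)", OF refl sum.cong[OF refl]])
    fix k assume k: "k \<in> T"
    have alg: "u * (s * e / (- x)) + v * ((1 + s / x) * e) = v * e + s * ((v - u) / x * e)"
      if "x \<noteq> 0" for u v x e :: real
      using that by (simp add: field_simps)
    have "real_of_int (a - k) = - real_of_int (k - a)" "real_of_int (k - a) \<noteq> 0" using T k by auto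
    then show "g a * (s * ?c k / real_of_int (a - k)) + g k * ((1 + s / real_of_int (k - a)) * ?c k)
      = g k * ?c k + s * ((g k - g a) / real_of_int (k - a) * ?c k)"
      using alg by (simp only: not_False_eq_True)
  qed
  finally show ?thesis by (simp add: sum.distrib sum_distrib_left)
qed

lemma abs_shift_weight_le:
  assumes "finite T" "\<bar>s\<bar> \<le> 1"
  shows "\<bar>shift_weight s T k\<bar> \<le> 2 ^ card T"
proof -
  have "\<bar>shift_weight s T k\<bar> = (\<Prod>j\<in>T - {k}. \<bar>1 + s / real_of_int (k - j)\<bar>)"
    by (simp add: shift_weight_def abs_prod)
  also have "\<dots> \<le> (\<Prod>j\<in>T - {k}. 2)"
  proof (rule prod_mono)
    fix j assume "j \<in> T - {k}"
    then have "1 \<le> \<bar>k - j\<bar>" by auto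
    then have 1: "1 \<le> \<bar>real_of_int (k - j)\<bar>" by linarith
    have "\<bar>s / real_of_int (k - j)\<bar> \<le> 1"
      using 1 assms(2) unfolding abs_divide by (subst divide_le_eq_1_pos) linarith+
    then show "0 \<le> \<bar>1 + s / real_of_int (k - j)\<bar> \<and> \<bar>1 + s / real_of_int (k - j)\<bar> \<le> 2"
      by linarith
  qed
  also have "\<dots> = 2 ^ card (T - {k})" by simp
  also have "\<dots> \<le> 2 ^ card T" using assms(1) by (intro power_increasing card_mono) auto
  finally show ?thesis .
qed

lemma shift_weight_nonneg:
  assumes "\<bar>s\<bar> \<le> 1"
  shows "0 \<le> shift_weight s T k"
  unfolding shift_weight_def
proof (rule prod_nonneg)
  fix j assume "j \<in> T - {k}"
  then have "1 \<le> \<bar>k - j\<bar>" by auto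
  then have 1: "1 \<le> \<bar>real_of_int (k - j)\<bar>" by linarith
  have "\<bar>s / real_of_int (k - j)\<bar> \<le> 1"
    using 1 assms unfolding abs_divide by (subst divide_le_eq_1_pos) linarith+
  then show "0 \<le> 1 + s / real_of_int (k - j)" by linarith
qed

text \<open>The two directions \<open>s = 1\<close> and \<open>s = -1\<close> have the same cubic leading term, so the drift of
  the sum of squares is quadratic and not cubic.\<close>
lemma weighted_cubes:
  fixes Q :: real
  assumes T: "finite T" "card T \<le> N" and s: "\<bar>s\<bar> \<le> 1"
    and Q: "\<And>k. k \<in> T \<Longrightarrow> (real_of_int k)\<^sup>2 \<le> Q"
  shows "\<bar>(\<Sum>k\<in>T. (real_of_int k)^3 * shift_weight s T k) - (\<Sum>k\<in>T. (real_of_int k)^3)\<bar>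
    \<le> card T * (N * (3 * Q * 2^N))"
  using assms
proof (induction T rule: finite_induct)
  case (insert a T)
  let ?g = "\<lambda>k. (real_of_int k)^3"
  have cT: "card T \<le> N" using insert by simp
  have Q0: "0 \<le> Q" using insert.prems(3)[of a] by (meson insertI1 order_trans zero_le_power2)
  have IH: "\<bar>(\<Sum>k\<in>T. ?g k * shift_weight s T k) - (\<Sum>k\<in>T. ?g k)\<bar> \<le> card T * (N * (3 * Q * 2^N))"
    by (rule insert.IH) (use insert.prems cT in auto)
  have "\<bar>\<Sum>k\<in>T. (?g k - ?g a) / real_of_int (k - a) * shift_weight s T k\<bar> \<le> (\<Sum>k\<in>T. 3 * Q * 2^N)"
  proof (rule order_trans[OF sum_abs], rule sum_mono)
    fix k assume k: "k \<in> T"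
    let ?k = "real_of_int k" and ?a = "real_of_int a"
    have "real_of_int (k - a) \<noteq> 0" using k insert.hyps by auto
    then have eq: "(?g k - ?g a) / real_of_int (k - a) = ?k\<^sup>2 + ?k * ?a + ?a\<^sup>2"
      by (simp add: field_simps power2_eq_square power3_eq_cube)
    have "?k\<^sup>2 \<le> Q" "?a\<^sup>2 \<le> Q" using insert.prems(3) k by auto
    \<comment> \<open>The two squares bound the mixed product \<open>?k * ?a\<close> by
      \<open>Q\<close> in absolute value.\<close>
    moreover have "0 \<le> (?k - ?a)\<^sup>2" "0 \<le> (?k + ?a)\<^sup>2" by simp_all
    ultimately have 1: "\<bar>(?g k - ?g a) / real_of_int (k - a)\<bar> \<le> 3 * Q"
      unfolding eq by (simp add: power2_eq_square algebra_simps abs_le_iff)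
    have "\<bar>shift_weight s T k\<bar> \<le> 2 ^ card T" by (rule abs_shift_weight_le[OF insert.hyps(1) s])
    also have "\<dots> \<le> 2 ^ N" using cT by (intro power_increasing) auto
    finally have 2: "\<bar>shift_weight s T k\<bar> \<le> 2 ^ N" .
    show "\<bar>(?g k - ?g a) / real_of_int (k - a) * shift_weight s T k\<bar> \<le> 3 * Q * 2^N"
      unfolding abs_mult using 1 2 Q0 by (intro mult_mono) auto
  qed
  also have "\<dots> = card T * (3 * Q * 2^N)" by simp
  also have "\<dots> \<le> N * (3 * Q * 2^N)" using cT Q0 by (intro mult_right_mono) auto
  finally have 1: "\<bar>\<Sum>k\<in>T. (?g k - ?g a) / real_of_int (k - a) * shift_weight s T k\<bar> \<le> N * (3 * Q * 2^N)" .
  have "\<bar>s\<bar> * \<bar>\<Sum>k\<in>T. (?g k - ?g a) / real_of_int (k - a) * shift_weight s T k\<bar> \<le> 1 * (N * (3 * Q * 2^N))"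
    using s 1 by (intro mult_mono) auto
  then have "\<bar>s * (\<Sum>k\<in>T. (?g k - ?g a) / real_of_int (k - a) * shift_weight s T k)\<bar> \<le> N * (3 * Q * 2^N)"
    by (simp add: abs_mult)
  moreover have "(\<Sum>k\<in>insert a T. ?g k) = (\<Sum>k\<in>T. ?g k) + ?g a" using insert.hyps by simp
  moreover have "card (insert a T) * (N * (3 * Q * 2^N)) = card T * (N * (3 * Q * 2^N)) + N * (3 * Q * 2^N)"
    using insert.hyps by (simp add: algebra_simps)
  ultimately show ?case
    using IH unfolding weighted_sum_insert[where g="?g", OF insert.hyps] by linarith
qed simp

section \<open>The chain on strictly decreasing tuples\<close>

lemma Omega_nth_less: "n \<in> Omega N \<Longrightarrow> i < j \<Longrightarrow> j < N \<Longrightarrow> n ! j < n ! i"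
  by (auto simp: Omega_def sorted_wrt_iff_nth_less)

lemma Omega_nth_eq_iff: "n \<in> Omega N \<Longrightarrow> i < N \<Longrightarrow> j < N \<Longrightarrow> n ! i = n ! j \<longleftrightarrow> i = j"
  using Omega_nth_less[of n N i j] Omega_nth_less[of n N j i] by (metis less_irrefl linorder_neqE_nat)

lemma Omega_nth_bij:
  assumes "n \<in> Omega N"
  shows "bij_betw ((!) n) {..<N} (set n)"
proof -
  have "length n = N" using assms by (simp add: Omega_def)
  then show ?thesis
    using Omega_nth_eq_iff[OF assms] by (auto simp: bij_betw_def inj_on_def in_set_conv_nth)
qed

lemma Omega_nonempty: "Omega N \<noteq> {}"
proof -
  have "rev (map int [0..<N]) \<in> Omega N"
    by (simp add: Omega_def sorted_wrt_rev sorted_wrt_map)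
  then show ?thesis by blast
qed

text \<open>Only factors involving position \<open>k\<close> change; the others cancel.\<close>

lemma Vdm_ratio:
  assumes n: "n \<in> Omega N" and k: "k < N"
  shows "real_of_int (Vdm (n[k := n ! k + s])) / real_of_int (Vdm n)
    = shift_weight (real_of_int s) (set n) (n ! k)"
proof -
  have len: "length n = N" using n by (simp add: Omega_def)
  let ?m = "n[k := n ! k + s]"
  define q where "q j = 1 + real_of_int s / real_of_int (n ! k - n ! j)" for j
  define \<rho> where "\<rho> i j = real_of_int (?m ! i - ?m ! j) / real_of_int (n ! i - n ! j)" for i j
  have rho_1: "\<rho> i j = 1" if "i < j" "j < N" "i \<noteq> k" "j \<noteq> k" for i j
    using Omega_nth_less[OF n that(1,2)] that by (simp add: \<rho>_def)
  \<comment> \<open>To the left of \<open>k\<close> both the shift and the denominator change sign,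
    so the factor has the same form as to the right.\<close>
  have rho_l: "\<rho> i k = q i" if "i < k" for i
    using Omega_nth_less[OF n that k] that k len by (simp add: \<rho>_def q_def field_simps)
  have rho_r: "\<rho> k j = q j" if "k < j" "j < N" for j
    using Omega_nth_less[OF n that] that k len by (simp add: \<rho>_def q_def field_simps)
  have inner: "(\<Prod>j\<in>{i<..<N}. \<rho> i j)
      = (if i < k then q i else if i = k then (\<Prod>j\<in>{k<..<N}. q j) else 1)" if i: "i < N" for i
  proof -
    consider "i < k" | "i = k" | "k < i" by linarith
    then show ?thesis
    proof cases
      case 1
      have "(\<Prod>j\<in>{i<..<N}. \<rho> i j) = (\<Prod>j\<in>{k}. \<rho> i j)"
        using 1 k by (intro prod.mono_neutral_right) (auto intro: rho_1)
      then show ?thesis using 1 rho_l by simp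
    next
      case 2
      then show ?thesis using rho_r by (auto intro: prod.cong)
    next
      case 3
      then have "(\<Prod>j\<in>{i<..<N}. \<rho> i j) = (\<Prod>j\<in>{i<..<N}. 1)"
        by (intro prod.cong) (auto intro: rho_1)
      then show ?thesis using 3 by simp
    qed
  qed
  have split: "{..<N} = insert k ({..<k} \<union> {k<..<N})" using k by auto
  have "real_of_int (Vdm ?m) / real_of_int (Vdm n) = (\<Prod>i<N. \<Prod>j\<in>{i<..<N}. \<rho> i j)"
    by (simp add: Vdm_def len \<rho>_def prod_dividef)
  also have "\<dots> = (\<Prod>i<N. if i < k then q i else if i = k then (\<Prod>j\<in>{k<..<N}. q j) else 1)"
    using inner by (intro prod.cong) auto
  also have "\<dots> = (\<Prod>j\<in>{k<..<N}. q j) *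
      (\<Prod>i\<in>{..<k} \<union> {k<..<N}. if i < k then q i else if i = k then (\<Prod>j\<in>{k<..<N}. q j) else 1)"
    unfolding split by (subst prod.insert) auto
  also have "(\<Prod>i\<in>{..<k} \<union> {k<..<N}. if i < k then q i else if i = k then (\<Prod>j\<in>{k<..<N}. q j) else 1)
      = (\<Prod>i<k. q i)"
    by (rule prod.mono_neutral_cong_right) auto
  also have "(\<Prod>j\<in>{k<..<N}. q j) * (\<Prod>i<k. q i) = (\<Prod>j\<in>{..<k} \<union> {k<..<N}. q j)"
    by (subst prod.union_disjoint) auto
  also have "{..<k} \<union> {k<..<N} = {..<N} - {k}" using k by auto
  also have "(\<Prod>j\<in>{..<N} - {k}. q j)
      = (\<Prod>v\<in>set n - {n ! k}. 1 + real_of_int s / real_of_int (n ! k - v))"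
  proof -
    have "bij_betw ((!) n) ({..<N} - {k}) (set n - {n ! k})"
      using Omega_nth_bij[OF n] k unfolding bij_betw_def
      by (auto simp: inj_on_diff inj_on_image_set_diff[of _ "{..<N}"])
    from prod.reindex_bij_betw[OF this] show ?thesis by (simp add: q_def)
  qed
  finally show ?thesis by (simp add: shift_weight_def)
qed

text \<open>A collision of the moved entry with another one produces a zero factor in the weight;
  without a collision a unit move cannot break the strict order.\<close>

lemma update_in_Omega:
  assumes n: "n \<in> Omega N" and k: "k < N" and s: "s \<in> {1, -1::int}"
    and nz: "shift_weight (real_of_int s) (set n) (n ! k) \<noteq> 0"
  shows "n[k := n ! k + s] \<in> Omega N"
proof -
  have len: "length n = N" using n by (simp add: Omega_def)
  have ne: "n ! k + s \<noteq> n ! j" if j: "j < N" "j \<noteq> k" for j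
  proof
    assume eq: "n ! k + s = n ! j"
    have "n ! j \<in> set n - {n ! k}" using j len k Omega_nth_eq_iff[OF n j(1) k] by simp
    moreover have "1 + real_of_int s / real_of_int (n ! k - n ! j) = 0"
    proof -
      have "n ! k - n ! j = - s" using eq by linarith
      then show ?thesis using s by (elim insertE) simp_all
    qed
    ultimately have "shift_weight (real_of_int s) (set n) (n ! k) = 0"
      unfolding shift_weight_def by (intro prod_zero) auto
    with nz show False by contradiction
  qed
  have "n[k := n ! k + s] ! j < n[k := n ! k + s] ! i" if ij: "i < j" "j < N" for i j
  proof -
    note less = Omega_nth_less[OF n ij]
    have s1: "\<bar>s\<bar> \<le> 1" using s by auto
    consider "i = k" | "j = k" | "i \<noteq> k" "j \<noteq> k" by blast
    then show ?thesis
    proof cases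
      case 1
      then have "n ! k + s \<noteq> n ! j" using ij by (intro ne) auto
      then have "n ! j < n ! k + s" using less s1 unfolding 1 by linarith
      then show ?thesis using 1 ij k len by simp
    next
      case 2
      then have "n ! k + s \<noteq> n ! i" using ij by (intro ne) auto
      then have "n ! k + s < n ! i" using less s1 unfolding 2 by linarith
      then show ?thesis using 2 ij k len by simp
    qed (use less in simp)
  qed
  then show ?thesis using len by (simp add: Omega_def sorted_wrt_iff_nth_less)
qed

section \<open>The Lyapunov function and its drift on tuples\<close>

definition Phi :: "int list \<Rightarrow> real" where
  "Phi n = 1 + (\<Sum>k<length n. (real_of_int (n ! k))\<^sup>2)"

lemma Phi_ge: "k < length n \<Longrightarrow> 1 + (real_of_int (n ! k))\<^sup>2 \<le> Phi n"
  unfolding Phi_def using member_le_sum[of k "{..<length n}" "\<lambda>k. (real_of_int (n ! k))\<^sup>2"] by simp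

lemma Phi_ge_1: "1 \<le> Phi n"
  unfolding Phi_def by (simp add: sum_nonneg)

lemma Phi_update:
  assumes "k < length n"
  shows "Phi (n[k := v]) = Phi n - (real_of_int (n ! k))\<^sup>2 + (real_of_int v)\<^sup>2"
proof -
  let ?R = "{..<length n} - {k}"
  have split: "(\<Sum>i<length n. (real_of_int (m ! i))\<^sup>2)
      = (real_of_int (m ! k))\<^sup>2 + (\<Sum>i\<in>?R. (real_of_int (m ! i))\<^sup>2)" for m
    by (rule sum.remove) (use assms in auto)
  have "(\<Sum>i\<in>?R. (real_of_int (n[k := v] ! i))\<^sup>2) = (\<Sum>i\<in>?R. (real_of_int (n ! i))\<^sup>2)"
    by (rule sum.cong) auto
  then show ?thesis
    using split[of n] split[of "n[k := v]"] assms unfolding Phi_def length_list_update by simp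
qed

lemma finite_Phi_sublevel: "finite {n \<in> Omega N. Phi n \<le> R}"
proof (rule finite_subset)
  let ?m = "\<lceil>R\<rceil>"
  show "{n \<in> Omega N. Phi n \<le> R} \<subseteq> {xs. set xs \<subseteq> {- ?m..?m} \<and> length xs = N}"
  proof (rule subsetI, elim CollectE conjE)
    fix n assume n: "n \<in> Omega N" "Phi n \<le> R"
    have "v \<in> {- ?m..?m}" if v: "v \<in> set n" for v
    proof -
      obtain k where k: "k < length n" "n ! k = v" using v by (auto simp: in_set_conv_nth)
      have "\<bar>v\<bar> \<le> v\<^sup>2"
      proof (cases "v = 0")
        case False
        then have "\<bar>v\<bar> * 1 \<le> \<bar>v\<bar> * \<bar>v\<bar>" by (intro mult_left_mono) auto
        then show ?thesis by (simp add: power2_eq_square)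
      qed simp
      then have "real_of_int \<bar>v\<bar> \<le> (real_of_int v)\<^sup>2" by (simp flip: of_int_power)
      also have "\<dots> \<le> R" using Phi_ge[OF k(1)] n(2) unfolding k(2) by linarith
      finally have "real_of_int \<bar>v\<bar> \<le> real_of_int ?m" using le_of_int_ceiling[of R] by linarith
      then have "\<bar>v\<bar> \<le> ?m" unfolding of_int_le_iff .
      then show ?thesis by auto
    qed
    then have "set n \<subseteq> {- ?m..?m}" by blast
    moreover have "length n = N" using n(1) by (simp add: Omega_def)
    ultimately show "n \<in> {xs. set xs \<subseteq> {- ?m..?m} \<and> length xs = N}" by blast
  qed
  show "finite {xs. set xs \<subseteq> {- ?m..?m} \<and> length xs = N}" by (rule finite_lists_length_eq) simp
qed

definition jump :: "nat \<times> int \<Rightarrow> int list \<Rightarrow> int list" where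
  "jump i n = n[fst i := n ! fst i + snd i]"

text \<open>\<beta> stands for the quadratic coefficients of the difference operator; the Lyapunov
  estimates use their sign and their leading term.\<close>

definition rate :: "(int \<Rightarrow> int \<Rightarrow> real) \<Rightarrow> nat \<times> int \<Rightarrow> int list \<Rightarrow> real" where
  "rate \<beta> i n = shift_weight (real_of_int (snd i)) (set n) (n ! fst i) * \<beta> (snd i) (n ! fst i)"

text \<open>The first summand bounds the total rate: \<open>2 * N\<close> jumps, weights at most
  \<open>2^N\<close>, coefficients at most \<open>(1 + 2 * c) * Phi\<close>. The bracket bounds the
  deviation from the sum of cubes, counted twice for the two directions and twice for the factor in
  \<open>2 * s * v + 1\<close>. The 8 serves the bounds on single jumps.\<close>

definition drift_const :: "nat \<Rightarrow> real \<Rightarrow> real" where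
  "drift_const N c = 2 * N * (2^N * (1 + 2 * c)) + 4 * (N * (2 * c * 2^N) + N * (N * (3 * 2^N))) + 8"

lemma lyapunov_chain_Omega:
  fixes \<beta> :: "int \<Rightarrow> int \<Rightarrow> real"
  assumes nonneg: "\<And>s v. s \<in> {1, -1} \<Longrightarrow> 0 \<le> \<beta> s v" and c: "0 \<le> c"
    and quad: "\<And>s v. s \<in> {1, -1} \<Longrightarrow> \<bar>\<beta> s v - (real_of_int v)\<^sup>2\<bar> \<le> c * (1 + \<bar>real_of_int v\<bar>)"
  shows "lyapunov_chain (Omega N) ({..<N} \<times> {1, -1}) (rate \<beta>) jump Phi (drift_const N c)"
proof
  let ?I = "{..<N} \<times> {1, -1::int}"
  define M1 where "M1 = 2 * real N * (2^N * (1 + 2 * c))"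
  define M2 where "M2 = real N * (2 * c * 2^N) + real N * (real N * (3 * 2^N))"
  have M: "drift_const N c = M1 + 4 * M2 + 8" by (simp add: drift_const_def M1_def M2_def)
  have M1: "0 \<le> M1" and M2: "0 \<le> M2" using c by (simp_all add: M1_def M2_def)
  have lin: "\<bar>x\<bar> \<le> 1 + x\<^sup>2" for x :: real
  proof -
    have "0 \<le> (\<bar>x\<bar> - 1)\<^sup>2" by simp
    then have "2 * \<bar>x\<bar> \<le> 1 + x\<^sup>2" by (simp add: power2_diff)
    then show ?thesis by linarith
  qed
  have len: "length n = N" if "n \<in> Omega N" for n using that by (simp add: Omega_def)
  show "finite ?I" by simp
  show M_ge: "1 \<le> drift_const N c" unfolding M using M1 M2 by linarith
  show "1 \<le> Phi n" for n by (rule Phi_ge_1)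
  show "finite {n \<in> Omega N. Phi n \<le> R}" for R by (rule finite_Phi_sublevel)
  show rate_nn: "0 \<le> rate \<beta> i n" if "i \<in> ?I" for i n
    unfolding rate_def using that by (intro mult_nonneg_nonneg shift_weight_nonneg nonneg) auto
  show "jump i n \<in> Omega N" if "i \<in> ?I" "n \<in> Omega N" "rate \<beta> i n \<noteq> 0" for i n
    unfolding jump_def using that by (intro update_in_Omega) (auto simp: rate_def)
  have weight: "\<bar>shift_weight (real_of_int s) (set n) v\<bar> \<le> 2^N"
    if "n \<in> Omega N" "s \<in> {1, -1}" for n s v
  proof -
    have "card (set n) = N" using bij_betw_same_card[OF Omega_nth_bij[OF that(1)]] by simp
    then show ?thesis using abs_shift_weight_le[of "set n" "real_of_int s" v] that(2) by auto
  qed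
  have rate_bound: "(\<Sum>i\<in>?I. rate \<beta> i n) \<le> M1 * Phi n" if n: "n \<in> Omega N" for n
  proof -
    have "(\<Sum>i\<in>?I. rate \<beta> i n) \<le> (\<Sum>i\<in>?I. 2^N * ((1 + 2 * c) * Phi n))"
    proof (rule sum_mono)
      fix i assume i: "i \<in> ?I"
      let ?v = "real_of_int (n ! fst i)"
      have v: "1 + ?v\<^sup>2 \<le> Phi n" using i len[OF n] by (intro Phi_ge) auto
      have "\<beta> (snd i) (n ! fst i) \<le> ?v\<^sup>2 + c * (1 + \<bar>?v\<bar>)" using quad[of "snd i" "n ! fst i"] i by auto
      moreover have "c * (1 + \<bar>?v\<bar>) \<le> c * (2 * Phi n)"
        using lin[of ?v] v c Phi_ge_1[of n] by (intro mult_left_mono) linarith+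
      ultimately have b: "\<beta> (snd i) (n ! fst i) \<le> (1 + 2 * c) * Phi n" using v by (simp add: algebra_simps)
      show "rate \<beta> i n \<le> 2^N * ((1 + 2 * c) * Phi n)"
        unfolding rate_def using weight[OF n, of "snd i" "n ! fst i"] i b nonneg[of "snd i" "n ! fst i"]
        by (intro mult_mono) auto
    qed
    also have "\<dots> = M1 * Phi n" by (simp add: M1_def)
    finally show ?thesis .
  qed
  show "(\<Sum>i\<in>?I. rate \<beta> i n) \<le> drift_const N c * Phi n" if "n \<in> Omega N" for n
  proof -
    have "M1 * Phi n \<le> drift_const N c * Phi n"
      unfolding M using M2 Phi_ge_1[of n] by (intro mult_right_mono) linarith+
    then show ?thesis using rate_bound[OF that] by linarith
  qed
  have diff: "Phi (jump i n) - Phi n = 2 * real_of_int (snd i) * real_of_int (n ! fst i) + 1"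
    if "i \<in> ?I" "n \<in> Omega N" for i n
    using that len[OF that(2)] by (auto simp: jump_def Phi_update power2_sum power2_diff)
  show "(Phi (jump i n) - Phi n)\<^sup>2 \<le> drift_const N c * Phi n" if i: "i \<in> ?I" and n: "n \<in> Omega N" for i n
  proof -
    let ?v = "real_of_int (n ! fst i)"
    have v: "1 + ?v\<^sup>2 \<le> Phi n" using i len[OF n] by (intro Phi_ge) auto
    have "0 \<le> (2 * ?v - 1)\<^sup>2" "0 \<le> (2 * ?v + 1)\<^sup>2" by simp_all
    then have "(2 * real_of_int (snd i) * ?v + 1)\<^sup>2 \<le> 8 * (1 + ?v\<^sup>2)"
      using i by (auto simp: power2_eq_square algebra_simps)
    also have "\<dots> \<le> drift_const N c * Phi n"
      unfolding M using v M1 M2 by (intro mult_mono) auto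
    finally show ?thesis unfolding diff[OF i n] .
  qed
  show "Phi n \<le> drift_const N c * Phi (jump i n)" if i: "i \<in> ?I" and n: "n \<in> Omega N" for i n
  proof -
    let ?v = "real_of_int (n ! fst i)"
    have v: "1 + ?v\<^sup>2 \<le> Phi n" using i len[OF n] by (intro Phi_ge) auto
    have d: "Phi (jump i n) = Phi n + (2 * real_of_int (snd i) * ?v + 1)" using diff[OF i n] by simp
    \<comment> \<open>With \<open>1 + ?v^2 \<le> Phi n\<close> the claim reduces to nonnegativity of
      \<open>7 * ?v^2 + 15\<close> plus or minus \<open>16 * ?v\<close>, which follows from these
      squares.\<close>
    have "0 \<le> (?v - 1)\<^sup>2" "0 \<le> (?v + 1)\<^sup>2" "0 \<le> (2 * ?v - 3)\<^sup>2" "0 \<le> (2 * ?v + 3)\<^sup>2" by simp_all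
    then have "Phi n \<le> 8 * Phi (jump i n)"
      using i v unfolding d by (auto simp: power2_eq_square algebra_simps)
    also have "\<dots> \<le> drift_const N c * Phi (jump i n)"
      unfolding M using M1 M2 Phi_ge_1[of "jump i n"] by (intro mult_right_mono) linarith+
    finally show ?thesis .
  qed
  show "\<bar>\<Sum>i\<in>?I. rate \<beta> i n * (Phi (jump i n) - Phi n)\<bar> \<le> drift_const N c * Phi n"
    if n: "n \<in> Omega N" for n
  proof -
    let ?v = "\<lambda>k. real_of_int (n ! k)"
    let ?w = "\<lambda>s k. shift_weight (real_of_int s) (set n) (n ! k)"
    \<comment> \<open>Both directions are compared with the same sum of cubes:
      \<open>weighted_cubes\<close> handles the weights, and the linear bound on \<beta> minus the
      square handles the coefficients.\<close>
    have lead: "\<bar>(\<Sum>k<N. ?v k * (?w s k * \<beta> s (n ! k))) - (\<Sum>k<N. ?v k ^ 3)\<bar> \<le> M2 * Phi n"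
      if s: "s \<in> {1, -1}" for s
    proof -
      have "\<bar>\<Sum>k<N. ?w s k * (?v k * (\<beta> s (n ! k) - (?v k)\<^sup>2))\<bar> \<le> (\<Sum>k<N. 2^N * (2 * c * Phi n))"
      proof (rule order_trans[OF sum_abs], rule sum_mono)
        fix k assume k: "k \<in> {..<N}"
        have v: "1 + (?v k)\<^sup>2 \<le> Phi n" using k len[OF n] by (intro Phi_ge) auto
        have "\<bar>?v k * (\<beta> s (n ! k) - (?v k)\<^sup>2)\<bar> \<le> \<bar>?v k\<bar> * (c * (1 + \<bar>?v k\<bar>))"
          unfolding abs_mult using quad[OF s] by (intro mult_left_mono) auto
        also have "\<dots> = c * (\<bar>?v k\<bar> + (?v k)\<^sup>2)" by (simp add: algebra_simps power2_eq_square)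
        also have "\<dots> \<le> c * (2 * Phi n)" using v lin[of "?v k"] c by (intro mult_left_mono) linarith+
        finally have "\<bar>?v k * (\<beta> s (n ! k) - (?v k)\<^sup>2)\<bar> \<le> 2 * c * Phi n" by (simp add: mult_ac)
        then show "\<bar>?w s k * (?v k * (\<beta> s (n ! k) - (?v k)\<^sup>2))\<bar> \<le> 2^N * (2 * c * Phi n)"
          using weight[OF n s] unfolding abs_mult[of "?w s k"] by (intro mult_mono) auto
      qed
      also have "\<dots> = real N * (2 * c * 2^N) * Phi n" by simp
      finally have 1: "\<bar>\<Sum>k<N. ?w s k * (?v k * (\<beta> s (n ! k) - (?v k)\<^sup>2))\<bar> \<le> real N * (2 * c * 2^N) * Phi n" .
      have card: "card (set n) = N" using bij_betw_same_card[OF Omega_nth_bij[OF n]] by simp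
      have "\<bar>(\<Sum>v\<in>set n. (real_of_int v)^3 * shift_weight (real_of_int s) (set n) v) - (\<Sum>v\<in>set n. (real_of_int v)^3)\<bar>
        \<le> card (set n) * (N * (3 * Phi n * 2^N))"
      proof (rule weighted_cubes)
        fix v assume "v \<in> set n"
        then obtain k where "k < length n" "n ! k = v" by (auto simp: in_set_conv_nth)
        then show "(real_of_int v)\<^sup>2 \<le> Phi n" using Phi_ge[of k n] by auto
      qed (use card s in auto)
      then have 2: "\<bar>(\<Sum>k<N. ?v k ^ 3 * ?w s k) - (\<Sum>k<N. ?v k ^ 3)\<bar> \<le> N * (N * (3 * Phi n * 2^N))"
        unfolding card sum.reindex_bij_betw[OF Omega_nth_bij[OF n], symmetric] .
      have "(\<Sum>k<N. ?v k * (?w s k * \<beta> s (n ! k)))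
        = (\<Sum>k<N. ?w s k * (?v k * (\<beta> s (n ! k) - (?v k)\<^sup>2))) + (\<Sum>k<N. ?v k ^ 3 * ?w s k)"
        unfolding sum.distrib[symmetric]
        by (intro sum.cong) (simp_all add: algebra_simps power2_eq_square power3_eq_cube)
      with 1 2 have "\<bar>(\<Sum>k<N. ?v k * (?w s k * \<beta> s (n ! k))) - (\<Sum>k<N. ?v k ^ 3)\<bar>
        \<le> real N * (2 * c * 2^N) * Phi n + N * (N * (3 * Phi n * 2^N))" by linarith
      then show ?thesis by (simp add: M2_def algebra_simps)
    qed
    \<comment> \<open>A jump changes \<open>Phi\<close> by \<open>2 * s * v + 1\<close>, so the
      drift is the total rate plus twice a signed sum in which the cubes cancel.\<close>
    have "(\<Sum>i\<in>?I. rate \<beta> i n * (Phi (jump i n) - Phi n))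
      = (\<Sum>i\<in>?I. rate \<beta> i n + 2 * (real_of_int (snd i) * (?v (fst i) * rate \<beta> i n)))"
      using diff[OF _ n] by (intro sum.cong) (auto simp: algebra_simps)
    also have "\<dots> = (\<Sum>i\<in>?I. rate \<beta> i n)
      + 2 * (\<Sum>i\<in>?I. real_of_int (snd i) * (?v (fst i) * rate \<beta> i n))"
      by (simp only: sum.distrib sum_distrib_left)
    also have "(\<Sum>i\<in>?I. real_of_int (snd i) * (?v (fst i) * rate \<beta> i n))
      = (\<Sum>k<N. \<Sum>s\<in>{1, -1}. real_of_int s * (?v k * (?w s k * \<beta> s (n ! k))))"
      by (simp only: sum.cartesian_product case_prod_unfold rate_def)
    also have "\<dots> = (\<Sum>k<N. ?v k * (?w 1 k * \<beta> 1 (n ! k))) - (\<Sum>k<N. ?v k * (?w (-1) k * \<beta> (-1) (n ! k)))"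
      by (simp add: sum_subtractf)
    finally have eq: "(\<Sum>i\<in>?I. rate \<beta> i n * (Phi (jump i n) - Phi n)) = (\<Sum>i\<in>?I. rate \<beta> i n)
      + 2 * ((\<Sum>k<N. ?v k * (?w 1 k * \<beta> 1 (n ! k))) - (\<Sum>k<N. ?v k * (?w (-1) k * \<beta> (-1) (n ! k))))" .
    have "0 \<le> (\<Sum>i\<in>?I. rate \<beta> i n)" by (intro sum_nonneg rate_nn)
    then have "\<bar>\<Sum>i\<in>?I. rate \<beta> i n * (Phi (jump i n) - Phi n)\<bar> \<le> M1 * Phi n + 4 * (M2 * Phi n)"
      unfolding eq using rate_bound[OF n] lead[of 1] lead[of "-1"] by simp
    also have "\<dots> \<le> drift_const N c * Phi n"
      unfolding M using Phi_ge_1[of n] by (simp add: algebra_simps)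
    finally show ?thesis .
  qed
qed

section \<open>The generator\<close>

lemma C0_eq: "C0 N = vanishing (Omega N)"
  by (simp add: C0_def vanishing_def)

text \<open>The bound \<open>b\<close> is essential: a real supremum carries no information about an
  unbounded family. \<open>tendsto_0_if_supnorm\<close> asks for eventual boundedness for the same
  reason.\<close>

lemma abs_le_supnorm:
  assumes "\<And>x. x \<in> Omega N \<Longrightarrow> \<bar>u x\<bar> \<le> b" and "x \<in> Omega N"
  shows "\<bar>u x\<bar> \<le> supnorm N u"
  unfolding supnorm_def using assms by (intro cSUP_upper) (auto intro!: bdd_aboveI[of _ b])

lemma supnorm_le:
  assumes "\<And>x. x \<in> Omega N \<Longrightarrow> \<bar>u x\<bar> \<le> b"
  shows "supnorm N u \<le> b"
  unfolding supnorm_def using assms Omega_nonempty by (intro cSUP_least)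

lemma supnorm_tendsto_0:
  assumes "\<And>e. 0 < e \<Longrightarrow> eventually (\<lambda>t. \<forall>x\<in>Omega N. \<bar>u t x\<bar> \<le> e) F"
  shows "((\<lambda>t. supnorm N (u t)) \<longlongrightarrow> 0) F"
proof (rule tendstoI)
  fix e :: real assume e: "0 < e"
  obtain x where x: "x \<in> Omega N" using Omega_nonempty by blast
  show "eventually (\<lambda>t. dist (supnorm N (u t)) 0 < e) F"
    using assms[of "e/2"] e
  proof (auto elim!: eventually_mono)
    fix t assume "\<forall>x\<in>Omega N. \<bar>u t x\<bar> * 2 \<le> e"
    then have b: "\<And>x. x \<in> Omega N \<Longrightarrow> \<bar>u t x\<bar> \<le> e / 2" by simp
    show "\<bar>supnorm N (u t)\<bar> < e"
      using supnorm_le[of N "u t", OF b] abs_le_supnorm[of N "u t", OF b x] e by linarith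
  qed
qed

lemma tendsto_0_if_supnorm:
  assumes lim: "((\<lambda>t. supnorm N (u t)) \<longlongrightarrow> 0) F" and x: "x \<in> Omega N"
    and bdd: "eventually (\<lambda>t. \<exists>b. \<forall>x\<in>Omega N. \<bar>u t x\<bar> \<le> b) F"
  shows "((\<lambda>t. u t x) \<longlongrightarrow> 0) F"
  using _ lim
proof (rule Lim_null_comparison)
  show "eventually (\<lambda>t. norm (u t x) \<le> supnorm N (u t)) F"
    using bdd by eventually_elim (use abs_le_supnorm[OF _ x] in auto)
qed

text \<open>Every \<open>s\<close> other than 1 counts as a downward jump; the chain only uses 1 and
  -1.\<close>

definition jump_coeff :: "complex \<Rightarrow> complex \<Rightarrow> complex \<Rightarrow> complex \<Rightarrow> nat \<Rightarrow> int \<Rightarrow> int \<Rightarrow> real" where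
  "jump_coeff z z' w w' N s v =
    (if s = 1 then Re ((z + of_nat N - 1 - of_int v) * (z' + of_nat N - 1 - of_int v))
     else Re ((w + of_int v) * (w' + of_int v)))"

lemma jump_coeff_nonneg:
  assumes "admissible z z' w w'"
  shows "0 \<le> jump_coeff z z' w w' N s v"
proof -
  \<comment> \<open>Admissibility is used at the integer \<open>N - 1 - v\<close>.\<close>
  have "0 < Re ((z + of_int (int N - 1 - v)) * (z' + of_int (int N - 1 - v)))"
    using assms by (auto simp: admissible_def simp del: of_int_diff)
  moreover have "z + of_int (int N - 1 - v) = z + of_nat N - 1 - of_int v" for z :: complex by simp
  ultimately have "0 < Re ((z + of_nat N - 1 - of_int v) * (z' + of_nat N - 1 - of_int v))" by metis
  moreover have "0 < Re ((w + of_int v) * (w' + of_int v))" using assms by (auto simp: admissible_def)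
  ultimately show ?thesis by (simp add: jump_coeff_def)
qed

lemma jump_coeff_quadratic:
  obtains c where "0 \<le> c"
    "\<And>s v. \<bar>jump_coeff z z' w w' N s v - (real_of_int v)\<^sup>2\<bar> \<le> c * (1 + \<bar>real_of_int v\<bar>)"
proof -
  \<comment> \<open>The surplus \<open>d\<close> lets one constant cover the upward and the downward
    coefficient.\<close>
  have bound: "\<bar>p + q * x\<bar> \<le> (\<bar>p\<bar> + \<bar>q\<bar> + d) * (1 + \<bar>x\<bar>)" if "0 \<le> d" for p q x d :: real
  proof -
    have "\<bar>p + q * x\<bar> \<le> \<bar>p\<bar> + \<bar>q\<bar> * \<bar>x\<bar>" by (metis abs_mult abs_triangle_ineq)
    also have "\<dots> \<le> (\<bar>p\<bar> + \<bar>q\<bar> + d) * (1 + \<bar>x\<bar>)" using that by (simp add: algebra_simps)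
    finally show ?thesis .
  qed
  define a a' where "a = z + of_nat N - 1" and "a' = z' + of_nat N - 1"
  let ?u = "\<bar>Re (a * a')\<bar> + \<bar>- Re (a + a')\<bar>" and ?d = "\<bar>Re (w * w')\<bar> + \<bar>Re (w + w')\<bar>"
  show thesis
  proof (rule that[of "?u + ?d"])
    fix s v
    let ?x = "real_of_int v"
    have 1: "Re ((a - of_int v) * (a' - of_int v)) - ?x\<^sup>2 = Re (a * a') + (- Re (a + a')) * ?x"
      by (simp add: algebra_simps power2_eq_square)
    have 2: "Re ((w + of_int v) * (w' + of_int v)) - ?x\<^sup>2 = Re (w * w') + Re (w + w') * ?x"
      by (simp add: algebra_simps power2_eq_square)
    have "\<bar>Re (a * a') + (- Re (a + a')) * ?x\<bar> \<le> (?u + ?d) * (1 + \<bar>?x\<bar>)"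
      by (rule bound) simp
    moreover have "\<bar>Re (w * w') + Re (w + w') * ?x\<bar> \<le> (?d + ?u) * (1 + \<bar>?x\<bar>)"
      by (rule bound) simp
    ultimately show "\<bar>jump_coeff z z' w w' N s v - ?x\<^sup>2\<bar> \<le> (?u + ?d) * (1 + \<bar>?x\<bar>)"
      using 1 2 unfolding jump_coeff_def a_def[symmetric] a'_def[symmetric]
      by (simp only: add.commute split: if_split) simp
  qed simp
qed

lemma Dop_eq_sum:
  assumes n: "n \<in> Omega N"
  shows "Dop z z' w w' N f n
    = (\<Sum>i\<in>{..<N} \<times> {1, -1}. rate (jump_coeff z z' w w' N) i n * (f (jump i n) - f n))"
proof -
  have "(\<Sum>i\<in>{..<N} \<times> {1, -1}. rate (jump_coeff z z' w w' N) i n * (f (jump i n) - f n))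
    = (\<Sum>k<N. \<Sum>s\<in>{1, -1}. rate (jump_coeff z z' w w' N) (k, s) n * (f (jump (k, s) n) - f n))"
    by (simp only: sum.cartesian_product case_prod_unfold prod.collapse)
  also have "\<dots> = Dop z z' w w' N f n"
    unfolding Dop_def
  proof (rule sum.cong)
    fix k assume "k \<in> {..<N}"
    then have k: "k < N" by simp
    show "(\<Sum>s\<in>{1, -1}. rate (jump_coeff z z' w w' N) (k, s) n * (f (jump (k, s) n) - f n))
      = real_of_int (Vdm (shift_up n k)) / real_of_int (Vdm n)
          * Re ((z + of_nat N - 1 - of_int (n ! k)) * (z' + of_nat N - 1 - of_int (n ! k)))
          * (f (shift_up n k) - f n)
      + real_of_int (Vdm (shift_down n k)) / real_of_int (Vdm n)
          * Re ((w + of_int (n ! k)) * (w' + of_int (n ! k)))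
          * (f (shift_down n k) - f n)"
      using Vdm_ratio[OF n k, of 1] Vdm_ratio[OF n k, of "-1"]
      by (simp add: rate_def jump_def jump_coeff_def shift_up_def shift_down_def del: times_complex.sel)
  qed simp
  finally show ?thesis by simp
qed

theorem theorem5:
  fixes z z' w w' :: complex and N :: nat
  assumes "admissible z z' w w'" and "N \<ge> 1"
  shows "\<exists>p. feller_semigroup N p \<and>
           (\<forall>f\<in>C0 N. \<forall>g. generator_at N p f g \<longleftrightarrow>
               (Dop z z' w w' N f \<in> C0 N \<and> (\<forall>x\<in>Omega N. g x = Dop z z' w w' N f x)))"
proof -
  obtain c where c: "0 \<le> c"
    "\<And>s v. \<bar>jump_coeff z z' w w' N s v - (real_of_int v)\<^sup>2\<bar> \<le> c * (1 + \<bar>real_of_int v\<bar>)"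
    using jump_coeff_quadratic[of z z' w w' N] by blast
  interpret lyapunov_chain "Omega N" "{..<N} \<times> {1, -1}" "rate (jump_coeff z z' w w' N)" jump Phi
      "drift_const N c"
    using jump_coeff_nonneg[OF assms(1)] c by (intro lyapunov_chain_Omega)
  let ?D = "Dop z z' w w' N"
  have A_eq: "A f x = ?D f x" if "x \<in> Omega N" for f x
    using Dop_eq_sum[OF that] by (simp add: A_def)
  have kernel: "kernel_op N p t f x = P t f x" if "0 \<le> t" "f \<in> C0 N" "x \<in> Omega N" for t f x
    unfolding kernel_op_def using P_has_sum that by (intro infsumI) (auto simp: C0_eq)
  have kernel_C0: "kernel_op N p t f \<in> C0 N" if "0 \<le> t" "f \<in> C0 N" for t f
    using vanishing_cong[of "Omega N" "kernel_op N p t f" "P t f", OF kernel[OF that]]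
      P_vanishing[of t f] that by (simp add: C0_eq)
  \<comment> \<open>\<open>kernel_op\<close> and \<open>P\<close> are known to agree on
    \<open>Omega N\<close> only, which is all that a kernel sum sees.\<close>
  have kernel_cong: "kernel_op N p t f x = kernel_op N p t g x"
    if "\<And>y. y \<in> Omega N \<Longrightarrow> f y = g y" for t f g x
    unfolding kernel_op_def using that by (intro infsum_cong) auto
  have "feller_semigroup N p"
    unfolding feller_semigroup_def
  proof (intro conjI allI impI ballI)
    fix t x assume t: "(0::real) \<le> t" and x: "x \<in> Omega N"
    show "0 \<le> p t x y" for y by (rule p_nonneg[OF t x])
    show "p t x summable_on Omega N" using p_conservative[OF t x] by (rule has_sum_imp_summable)
    show "(\<Sum>\<^sub>\<infinity>y\<in>Omega N. p t x y) = 1" using p_conservative[OF t x] by (rule infsumI)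
  next
    fix t f assume "(0::real) \<le> t" "f \<in> C0 N"
    then show "kernel_op N p t f \<in> C0 N" by (rule kernel_C0)
  next
    fix f x assume "f \<in> C0 N" "x \<in> Omega N"
    then show "kernel_op N p 0 f x = f x" using kernel[of 0 f x] by (simp add: P_0)
  next
    fix s t f x assume s: "(0::real) \<le> s" and t: "(0::real) \<le> t" and f: "f \<in> C0 N" and x: "x \<in> Omega N"
    have "kernel_op N p s (kernel_op N p t f) x = kernel_op N p s (P t f) x"
      by (rule kernel_cong) (rule kernel[OF t f])
    also have "\<dots> = P s (P t f) x"
      using P_vanishing[OF t] f by (intro kernel s x) (auto simp: C0_eq)
    also have "\<dots> = kernel_op N p (s + t) f x"
      using P_semigroup[OF s t _ x, of f] kernel[of "s + t" f x] s t f x by (simp add: C0_eq)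
    finally show "kernel_op N p (s + t) f x = kernel_op N p s (kernel_op N p t f) x" by simp
  next
    fix f assume f: "f \<in> C0 N"
    show "((\<lambda>t. supnorm N (\<lambda>x. kernel_op N p t f x - f x)) \<longlongrightarrow> 0) (at_right 0)"
    proof (rule supnorm_tendsto_0)
      fix e :: real assume "0 < e"
      then have "eventually (\<lambda>t. \<forall>x\<in>Omega N. \<bar>P t f x - f x\<bar> \<le> e) (at_right 0)"
        using f by (intro P_strongly_continuous) (auto simp: C0_eq)
      with eventually_at_right_less[of "0::real"]
      show "eventually (\<lambda>t. \<forall>x\<in>Omega N. \<bar>kernel_op N p t f x - f x\<bar> \<le> e) (at_right 0)"
        by eventually_elim (simp add: kernel f)
    qed
  qed
  moreover have "generator_at N p f g \<longleftrightarrow> (?D f \<in> C0 N \<and> (\<forall>x\<in>Omega N. g x = ?D f x))"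
    if f: "f \<in> C0 N" for f g
  proof
    assume gen: "generator_at N p f g"
    then have g: "g \<in> C0 N"
      and lim: "((\<lambda>t. supnorm N (\<lambda>x. (kernel_op N p t f x - f x) / t - g x)) \<longlongrightarrow> 0) (at_right 0)"
      by (auto simp: generator_at_def)
    have eq: "g x = ?D f x" if x: "x \<in> Omega N" for x
    proof -
      \<comment> \<open>For each \<open>t > 0\<close> the difference quotient minus \<open>g\<close>
        vanishes at infinity, hence is bounded, and the supremum norm controls its values.\<close>
      have bdd: "eventually (\<lambda>t. \<exists>b. \<forall>x\<in>Omega N. \<bar>(kernel_op N p t f x - f x) / t - g x\<bar> \<le> b) (at_right 0)"
        using eventually_at_right_less[of "0::real"]
      proof eventually_elim
        case (elim t)
        have "(\<lambda>x. (1 / t) * (kernel_op N p t f x - f x) - g x) \<in> vanishing (Omega N)"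
          using kernel_C0[of t f] elim f g unfolding C0_eq
          by (intro vanishing_diff vanishing_scale) auto
        from vanishing_bounded[OF this] show ?case by (metis mult_1 times_divide_eq_left)
      qed
      have "((\<lambda>t. (kernel_op N p t f x - f x) / t - g x) \<longlongrightarrow> 0) (at_right 0)"
        by (rule tendsto_0_if_supnorm[OF lim x bdd])
      moreover have "eventually (\<lambda>t. (kernel_op N p t f x - f x) / t - g x = (P t f x - f x) / t - g x) (at_right 0)"
        using eventually_at_right_less[of "0::real"] by eventually_elim (simp add: kernel f x)
      ultimately have "((\<lambda>t. (P t f x - f x) / t - g x) \<longlongrightarrow> 0) (at_right 0)"
        by (simp cong: filterlim_cong add: tendsto_cong)
      then have "((\<lambda>t. (P t f x - f x) / t) \<longlongrightarrow> g x) (at_right 0)" by (simp add: LIM_zero_iff)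
      moreover have "((\<lambda>t. (P t f x - f x) / t) \<longlongrightarrow> A f x) (at_right 0)"
        using f x by (intro P_pointwise_derivative) (auto simp: C0_eq)
      ultimately have "g x = A f x" by (intro tendsto_unique[OF trivial_limit_at_right_real])
      then show ?thesis using A_eq[OF x] by simp
    qed
    then have "?D f \<in> C0 N" using g vanishing_cong[of "Omega N" g "?D f"] by (simp add: C0_eq)
    with eq show "?D f \<in> C0 N \<and> (\<forall>x\<in>Omega N. g x = ?D f x)" by blast
  next
    assume D: "?D f \<in> C0 N \<and> (\<forall>x\<in>Omega N. g x = ?D f x)"
    then have g: "g \<in> C0 N" using vanishing_cong[of "Omega N" g "?D f"] by (simp add: C0_eq)
    have Af: "A f \<in> vanishing (Omega N)"
      using D vanishing_cong[of "Omega N" "A f" "?D f"] A_eq by (simp add: C0_eq)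
    have "((\<lambda>t. supnorm N (\<lambda>x. (kernel_op N p t f x - f x) / t - g x)) \<longlongrightarrow> 0) (at_right 0)"
    proof (rule supnorm_tendsto_0)
      fix e :: real assume "0 < e"
      then have "eventually (\<lambda>t. \<forall>x\<in>Omega N. \<bar>(P t f x - f x) / t - A f x\<bar> \<le> e) (at_right 0)"
        using f Af by (intro generator_if) (auto simp: C0_eq)
      with eventually_at_right_less[of "0::real"]
      show "eventually (\<lambda>t. \<forall>x\<in>Omega N. \<bar>(kernel_op N p t f x - f x) / t - g x\<bar> \<le> e) (at_right 0)"
        by eventually_elim (use D in \<open>simp add: kernel f A_eq\<close>)
    qed
    with f g show "generator_at N p f g" by (simp add: generator_at_def)
  qed
  ultimately show ?thesis by blast
qed

end
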